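(* Let $T>0$ and assume that $V'$ is globally Lipschitz continuous. Let $(p(t),q(t))_{t\in[0,T]}$ be the solution of $$dq(t)=p(t)\,dt,\qquad dp(t)=-V'(q(t))\,dt+\Sigma\,dW(t),\qquad (p(0),q(0))=(p_0,q_0),$$ and let $(p_n,q_n)$ be given by the drift-preserving scheme $$\Psi_{n+1}=p_n+\Sigma\Delta W_n-\frac h2\int_0^1V'(q_n+sh\Psi_{n+1})\,ds,\quad q_{n+1}=q_n+h\Psi_{n+1},\quad p_{n+1}=p_n+\Sigma\Delta W_n-h\int_0^1V'(q_n+sh\Psi_{n+1})\,ds.$$ Then there exist $h^*>0$ and a constant $C>0$, where $C$ may depend on the initial data, on $T$ and on the coefficients of the SDE but not on $h$ and $n$, such that for all $0<h\le h^*$ with $Nh=T$ for an integer $N$, and all $n=1,\dots,N$, $$\left(\mathbb E\left[|q(t_n)-q_n|^2\right]\right)^{1/2}+\left(\mathbb E\left[|p(t_n)-p_n|^2\right]\right)^{1/2}\le Ch,\qquad t_n=nh.$$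
   Context: Let $m,d$ be positive integers, $(\Omega,\mathcal F,\mathbb P)$ a probability space with a normal filtration $(\mathcal F_t)_{t\in[0,T]}$, and $W$ a standard $\mathbb R^d$-valued $(\mathcal F_t)$-Brownian motion with continuous paths. $V\colon\mathbb R^m\to\mathbb R$ is a smooth potential with gradient $V'$, and $\Sigma\in\mathbb R^{m\times d}$ is a constant matrix. The separable Hamiltonian is $H(p,q)=\frac12\sum_{j=1}^m p_j^2+V(q)$. The initial values $(p_0,q_0)$ are $\mathcal F_0$-measurable with $\mathbb E[H(p_0,q_0)]<+\infty$ and $\mathbb E[|p_0|^2+|q_0|^2]<\infty$. The Wiener increments are $\Delta W_n=W(t_{n+1})-W(t_n)$; the same Brownian motion drives the SDE and the scheme, and both start from $(p_0,q_0)$. *)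

theory Defs
  imports "HOL-Probability.Probability"
begin

text \<open>In finite dimensions, \<open>f\<close> is of class \<open>C\<^sup>k\<close> iff all its directional derivatives up to order
  \<open>k\<close>, along constant directions, exist as Frechet derivatives and are continuous.\<close>

primrec higher_differentiable ::
    "nat \<Rightarrow> ('a::euclidean_space \<Rightarrow> 'b::real_normed_vector) \<Rightarrow> bool" where
  "higher_differentiable 0 f \<longleftrightarrow> continuous_on UNIV f"
| "higher_differentiable (Suc k) f \<longleftrightarrow>
     (\<forall>x. f differentiable (at x)) \<and>
     (\<forall>v. higher_differentiable k (\<lambda>x. frechet_derivative f (at x) v))"

definition smooth :: "('a::euclidean_space \<Rightarrow> 'b::real_normed_vector) \<Rightarrow> bool" where
  "smooth f \<longleftrightarrow> (\<forall>k. higher_differentiable k f)"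

definition hamiltonian :: "(real ^ 'm \<Rightarrow> real) \<Rightarrow> real ^ 'm \<Rightarrow> real ^ 'm \<Rightarrow> real" where
  "hamiltonian V p q = 1 / 2 * (\<Sum>j\<in>UNIV. (p $ j)\<^sup>2) + V q"

text \<open>Only the values \<open>F t\<close> for \<open>t \<in> {0..T}\<close> are constrained, and only their \<open>\<sigma>\<close>-algebras matter.
  Normality means that all null events belong to \<open>F 0\<close> and that \<open>F\<close> is right-continuous.\<close>

definition normal_filtration :: "'a measure \<Rightarrow> real \<Rightarrow> (real \<Rightarrow> 'a measure) \<Rightarrow> bool" where
  "normal_filtration M T F \<longleftrightarrow>
     (\<forall>t\<in>{0..T}. space (F t) = space M \<and> sets (F t) \<subseteq> sets M) \<and>
     (\<forall>s\<in>{0..T}. \<forall>t\<in>{s..T}. sets (F s) \<subseteq> sets (F t)) \<and>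
     null_sets M \<subseteq> sets (F 0) \<and>
     (\<forall>t\<in>{0..<T}. sets (F t) = (\<Inter>s\<in>{t<..T}. sets (F s)))"

text \<open>The increment over \<open>[s, t]\<close> is independent of \<open>F s\<close> and has the law \<open>N(0, (t - s) I)\<close>, i.e. its
  components are independent with variance \<open>t - s\<close>. The second parameter of
  \<^const>\<open>normal_density\<close> is the standard deviation.\<close>

definition brownian_motion ::
    "'a measure \<Rightarrow> real \<Rightarrow> (real \<Rightarrow> 'a measure) \<Rightarrow> (real \<Rightarrow> 'a \<Rightarrow> real ^ 'd) \<Rightarrow> bool" where
  "brownian_motion M T F W \<longleftrightarrow>
     (AE \<omega> in M. W 0 \<omega> = 0) \<and>
     (\<forall>\<omega>\<in>space M. continuous_on {0..T} (\<lambda>t. W t \<omega>)) \<and>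
     (\<forall>t\<in>{0..T}. W t \<in> borel_measurable (F t)) \<and>
     (\<forall>s t. 0 \<le> s \<and> s < t \<and> t \<le> T \<longrightarrow>
        prob_space.indep_set M
          (sets (vimage_algebra (space M) (\<lambda>\<omega>. W t \<omega> - W s \<omega>) borel)) (sets (F s)) \<and>
        prob_space.indep_vars M (\<lambda>_. borel) (\<lambda>i \<omega>. (W t \<omega> - W s \<omega>) $ i) UNIV \<and>
        (\<forall>i. distributed M lborel (\<lambda>\<omega>. (W t \<omega> - W s \<omega>) $ i) (normal_density 0 (sqrt (t - s)))))"

text \<open>Strong solutions of \<open>dq = p dt\<close>, \<open>dp = - V'(q) dt + \<Sigma> dW\<close> in integral form. As \<open>\<Sigma>\<close> is constant,
  the stochastic integral of \<open>\<Sigma>\<close> over \<open>[0, t]\<close> is \<open>\<Sigma> (W t - W 0)\<close>; the other integrands are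
  continuous in time.\<close>

definition sde_solution ::
    "'a measure \<Rightarrow> real \<Rightarrow> (real \<Rightarrow> 'a measure) \<Rightarrow> (real \<Rightarrow> 'a \<Rightarrow> real ^ 'd) \<Rightarrow>
     (real ^ 'm \<Rightarrow> real ^ 'm) \<Rightarrow> real ^ 'd ^ 'm \<Rightarrow> ('a \<Rightarrow> real ^ 'm) \<Rightarrow> ('a \<Rightarrow> real ^ 'm) \<Rightarrow>
     (real \<Rightarrow> 'a \<Rightarrow> real ^ 'm) \<Rightarrow> (real \<Rightarrow> 'a \<Rightarrow> real ^ 'm) \<Rightarrow> bool" where
  "sde_solution M T F W V' S p0 q0 p q \<longleftrightarrow>
     (\<forall>t\<in>{0..T}. p t \<in> borel_measurable (F t) \<and> q t \<in> borel_measurable (F t)) \<and>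
     (AE \<omega> in M. continuous_on {0..T} (\<lambda>t. p t \<omega>) \<and> continuous_on {0..T} (\<lambda>t. q t \<omega>)) \<and>
     (AE \<omega> in M. \<forall>t\<in>{0..T}.
        q t \<omega> = q0 \<omega> + integral {0..t} (\<lambda>s. p s \<omega>) \<and>
        p t \<omega> = p0 \<omega> - integral {0..t} (\<lambda>s. V' (q s \<omega>)) + S *v (W t \<omega> - W 0 \<omega>))"

text \<open>The scheme is implicit in \<open>\<Psi>\<close>, so it is given as a relation. \<open>\<Psi> (Suc n)\<close>, \<open>P n\<close>, \<open>Q n\<close> stand for
  the quantities with indices \<open>n + 1\<close>, \<open>n\<close>, \<open>n\<close> at step size \<open>h\<close>; \<open>\<Psi> 0\<close> is not used.\<close>

definition drift_preserving_scheme ::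
    "'a measure \<Rightarrow> (real \<Rightarrow> 'a \<Rightarrow> real ^ 'd) \<Rightarrow>
     (real ^ 'm \<Rightarrow> real ^ 'm) \<Rightarrow> real ^ 'd ^ 'm \<Rightarrow> ('a \<Rightarrow> real ^ 'm) \<Rightarrow> ('a \<Rightarrow> real ^ 'm) \<Rightarrow>
     real \<Rightarrow> nat \<Rightarrow>
     (nat \<Rightarrow> 'a \<Rightarrow> real ^ 'm) \<Rightarrow> (nat \<Rightarrow> 'a \<Rightarrow> real ^ 'm) \<Rightarrow> (nat \<Rightarrow> 'a \<Rightarrow> real ^ 'm) \<Rightarrow> bool" where
  "drift_preserving_scheme M W V' S p0 q0 h N \<Psi> P Q \<longleftrightarrow>
     (\<forall>\<omega>\<in>space M. P 0 \<omega> = p0 \<omega> \<and> Q 0 \<omega> = q0 \<omega> \<and>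
       (\<forall>n<N.
         (let \<Delta>W = W (real (Suc n) * h) \<omega> - W (real n * h) \<omega>;
              I = integral {0..1} (\<lambda>s. V' (Q n \<omega> + (s * h) *\<^sub>R \<Psi> (Suc n) \<omega>))
          in \<Psi> (Suc n) \<omega> = P n \<omega> + S *v \<Delta>W - (h / 2) *\<^sub>R I \<and>
             Q (Suc n) \<omega> = Q n \<omega> + h *\<^sub>R \<Psi> (Suc n) \<omega> \<and>
             P (Suc n) \<omega> = P n \<omega> + S *v \<Delta>W - h *\<^sub>R I)))"

end

theory Submission
  imports Defs
begin

text \<open>Since the noise is additive, scheme and solution can be compared path by path. The momenta differ
  by the integral of \<open>V'\<close> along \<open>q\<close> minus the integral of \<open>V'\<close> along the linear interpolation of the \<open>Q n\<close>,
  and \<open>q\<close> stays within \<open>\<integral> |p|\<close> over one step of its own interpolation, which yields a term of order \<open>h\<close>.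
  The positions contain in addition the quadrature error
  \<open>R n = h (X t\<^sub>1 + \<dots> + X t\<^sub>n) - \<integral> X\<close> of the noise \<open>X = \<Sigma> (W - W 0)\<close> over \<open>[0, t\<^sub>n]\<close>.
  A discrete Gronwall argument bounds the error linearly by \<open>|R n|\<close>, \<open>h \<Sum> |R k|\<close> and \<open>h\<close> times
  \<open>1 + |p0| + |q0| + \<integral> |X|\<close>. Only the \<open>L\<^sup>2\<close> norms of these quantities remain to be estimated, and that of \<open>R n\<close>
  is of order \<open>h\<close> because Brownian increments are orthogonal.\<close>

subsection \<open>Gronwall inequalities and integrals of paths\<close>

text \<open>The obstacle is the roughness of \<open>p\<close>. Its paths are no smoother than those
  of the noise, so a single rectangle rule for the integral of \<open>p\<close> has a mean-square
  error of order h^(3/2), and adding the norms of these errors over T / h steps would only give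
  order 1/2. Hence the noise is split off from \<open>p\<close>, and its quadrature errors are kept
  inside one sum, without norms, until expectations are taken. The momentum equation is harmless:
  the force is evaluated along \<open>q\<close>, which is differentiable in time, and the noise
  increments cancel. All other path quantities enter through sums or integrals over time, never
  through maxima, so the triangle inequality in mean square handles them. A solution is given by its
  integral equations alone and brings no moment bounds; a pathwise Gronwall estimate supplies them
  in terms of the initial values and the noise, which also makes the constant uniform over all
  solutions and driving Brownian motions. Likewise the scheme fixes \<open>\<Psi>\<close> only path
  by path, so the measurability behind the expectations has to be derived.\<close>

text \<open>Bounding the sum of the \<open>x k\<close>, not the last of them, leaves the
  \<open>b k\<close> free to vary irregularly. In the application \<open>b k\<close> contains the
  quadrature error at the k-th grid point, which is controlled on average over k.\<close>

lemma discrete_gronwall: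
  fixes x b :: "nat \<Rightarrow> real"
  assumes "a \<ge> 0" and b: "\<And>k. b k \<ge> 0"
    and x: "\<And>k. k < n \<Longrightarrow> x k \<le> b k + a * (\<Sum>j<k. x j)"
  shows "(\<Sum>k<n. x k) \<le> exp (a * real n) * (\<Sum>k<n. b k)"
  using x
proof (induction n)
  case 0
  then show ?case by simp
next
  case (Suc n)
  have IH: "(\<Sum>k<n. x k) \<le> exp (a * real n) * (\<Sum>k<n. b k)"
    using Suc by simp
  have "(\<Sum>k<Suc n. x k) \<le> b n + (1 + a) * (\<Sum>k<n. x k)"
    using Suc.prems[of n] by (simp add: algebra_simps)
  also have "\<dots> \<le> b n + (1 + a) * (exp (a * real n) * (\<Sum>k<n. b k))"
    using IH \<open>a \<ge> 0\<close> by (intro add_left_mono mult_left_mono) auto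
  also have "\<dots> \<le> b n + exp a * (exp (a * real n) * (\<Sum>k<n. b k))"
    using b by (intro add_left_mono mult_right_mono exp_ge_add_one_self mult_nonneg_nonneg sum_nonneg) auto
  also have "\<dots> = b n + exp (a * real (Suc n)) * (\<Sum>k<n. b k)"
    by (simp add: exp_add[symmetric] algebra_simps)
  also have "\<dots> \<le> exp (a * real (Suc n)) * b n + exp (a * real (Suc n)) * (\<Sum>k<n. b k)"
    using b[of n] \<open>a \<ge> 0\<close> mult_right_mono[of 1 "exp (a * real (Suc n))" "b n"] by simp
  finally show ?case by (simp add: algebra_simps)
qed

lemma integral_gronwall:
  fixes f b :: "real \<Rightarrow> real"
  assumes T: "0 \<le> T" and c: "0 \<le> c"
    and f: "continuous_on {0..T} f" and b: "continuous_on {0..T} b"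
    and b0: "\<And>t. t \<in> {0..T} \<Longrightarrow> 0 \<le> b t"
    and le: "\<And>t. t \<in> {0..T} \<Longrightarrow> f t \<le> b t + c * integral {0..t} f"
  shows "integral {0..T} f \<le> exp (c * T) * integral {0..T} b"
proof -
  \<comment> \<open>Integrating factor: the derivative is at most
    \<open>(exp (- c * t) - 1) * b t\<close>, which is nonpositive because \<open>b\<close> is
    nonnegative.\<close>
  define G where "G t = exp (- c * t) * integral {0..t} f - integral {0..t} b" for t
  have "G T \<le> G 0"
  proof (rule DERIV_nonpos_imp_decreasing_open[OF T])
    show "continuous_on {0..T} G"
      unfolding G_def
      by (intro continuous_intros indefinite_integral_continuous_1 integrable_continuous_real f b)
    fix t assume t: "0 < t" "t < T"
    have d: "((\<lambda>u. integral {0..u} g) has_real_derivative g t) (at t)"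
      if "continuous_on {0..T} g" for g :: "real \<Rightarrow> real"
    proof -
      have "((\<lambda>u. integral {0..u} g) has_real_derivative g t) (at t within {0..T})"
        using that t by (intro integral_has_real_derivative) auto
      moreover have "at t within {0..T} = at t"
        using t by (intro at_within_interior) auto
      ultimately show ?thesis by simp
    qed
    have "(G has_real_derivative
        exp (- c * t) * f t + (- c * exp (- c * t)) * integral {0..t} f - b t) (at t)"
      unfolding G_def by (auto intro!: derivative_eq_intros d f b)
    moreover have "exp (- c * t) * f t + (- c * exp (- c * t)) * integral {0..t} f - b t \<le> 0"
    proof -
      have "exp (- c * t) * (f t - c * integral {0..t} f) \<le> exp (- c * t) * b t"
        using le[of t] t by (intro mult_left_mono) auto
      also have "\<dots> \<le> 1 * b t"
        using b0[of t] t c by (intro mult_right_mono) auto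
      finally show ?thesis by (simp add: algebra_simps)
    qed
    ultimately show "\<exists>y. (G has_real_derivative y) (at t) \<and> y \<le> 0" by blast
  qed
  then have "exp (- c * T) * integral {0..T} f \<le> integral {0..T} b"
    by (simp add: G_def)
  then have "exp (c * T) * (exp (- c * T) * integral {0..T} f) \<le> exp (c * T) * integral {0..T} b"
    by (intro mult_left_mono) auto
  then show ?thesis by (simp add: mult.assoc[symmetric] exp_add[symmetric])
qed

lemma lipschitz_on_normD_UNIV:
  "L-lipschitz_on UNIV f \<Longrightarrow> norm (f x - f y) \<le> L * norm (x - y)"
  using lipschitz_onD[of L UNIV f x y] by (simp add: dist_norm)

text \<open>Source of all moment bounds for the solution: \<open>E\<close> is affine in the norms of
  the initial values and in the time integral of the noise, so it is square-integrable as soon as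
  these are.\<close>

lemma solution_integral_bound:
  fixes f :: "'v::euclidean_space \<Rightarrow> 'v" and p q X :: "real \<Rightarrow> 'v"
  assumes T: "0 \<le> T" and lip: "L-lipschitz_on UNIV f"
    and cp: "continuous_on {0..T} p" and cq: "continuous_on {0..T} q"
    and cX: "continuous_on {0..T} X"
    and q: "\<And>t. t \<in> {0..T} \<Longrightarrow> q t = q0 + integral {0..t} p"
    and p: "\<And>t. t \<in> {0..T} \<Longrightarrow> p t = p0 - integral {0..t} (\<lambda>s. f (q s)) + X t"
  defines "E \<equiv> exp ((L + 1) * T) *
    (T * (norm p0 + norm q0 + T * norm (f 0)) + integral {0..T} (\<lambda>s. norm (X s)))"
  shows "integral {0..T} (\<lambda>s. norm (p s)) \<le> E"
    and "integral {0..T} (\<lambda>s. norm (f (q s))) \<le> T * norm (f 0) + L * E"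
proof -
  have L: "L \<ge> 0" using lip by (rule lipschitz_on_nonneg)
  have cf: "continuous_on A f" for A
    using lipschitz_on_continuous_on[OF lip] by (rule continuous_on_subset) auto
  have cfq: "continuous_on {0..T} (\<lambda>s. f (q s))"
    by (rule continuous_on_compose2[OF cf[of UNIV] cq]) auto
  define g where "g s = norm (p s) + norm (q s)" for s
  have cg: "continuous_on {0..T} g" unfolding g_def by (intro continuous_intros cp cq)
  have sub: "continuous_on {0..t} w" if "continuous_on {0..T} w" "t \<in> {0..T}"
    for w :: "real \<Rightarrow> 'w::euclidean_space" and t
    using that by (auto intro: continuous_on_subset)
  note ii = integrable_continuous_real
  have fb: "norm (f x) \<le> norm (f 0) + L * norm x" for x
    using lipschitz_on_normD_UNIV[OF lip, of x 0] norm_triangle_sub[of "f x" "f 0"] by simp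
  have fqb: "integral {0..t} (\<lambda>s. norm (f (q s))) \<le> t * norm (f 0) + L * integral {0..t} g"
    if t: "t \<in> {0..T}" for t
  proof -
    have "integral {0..t} (\<lambda>s. norm (f (q s))) \<le> integral {0..t} (\<lambda>s. norm (f 0) + L * g s)"
    proof (rule integral_le)
      fix s assume "s \<in> {0..t}"
      have "L * norm (q s) \<le> L * g s"
        using L by (intro mult_left_mono) (auto simp: g_def)
      then show "norm (f (q s)) \<le> norm (f 0) + L * g s"
        using fb[of "q s"] by simp
    qed (intro ii continuous_intros sub[OF cfq] sub[OF cg] t)+
    also have "\<dots> = t * norm (f 0) + L * integral {0..t} g"
      using t by (subst integral_add) (auto intro!: ii continuous_intros sub[OF cg])
    finally show ?thesis .
  qed
  \<comment> \<open>Gronwall for \<open>norm (p s) + norm (q s)\<close>: the rate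
    \<open>L + 1\<close> consists of 1 from the position equation and \<open>L\<close> from the
    force. The noise stays inside the inhomogeneity as a function of time, so only its integral
    appears.\<close>
  have main: "integral {0..T} g \<le> exp ((L + 1) * T) * integral {0..T}
     (\<lambda>t. (norm p0 + norm q0 + T * norm (f 0)) + norm (X t))"
  proof (rule integral_gronwall)
    fix t assume t: "t \<in> {0..T}"
    have "norm (q t) \<le> norm q0 + integral {0..t} (\<lambda>s. norm (p s))"
    proof -
      have "norm (integral {0..t} p) \<le> integral {0..t} (\<lambda>s. norm (p s))"
        using t by (intro integral_norm_bound_integral ii continuous_intros sub[OF cp]) auto
      then show ?thesis using q[OF t] norm_triangle_ineq[of q0 "integral {0..t} p"] by simp
    qed
    also have "integral {0..t} (\<lambda>s. norm (p s)) \<le> integral {0..t} g"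
      using t by (intro integral_le ii continuous_intros sub[OF cp] sub[OF cg]) (auto simp: g_def)
    finally have 1: "norm (q t) \<le> norm q0 + integral {0..t} g" by simp
    have "norm (p t) \<le> norm p0 + norm (integral {0..t} (\<lambda>s. f (q s))) + norm (X t)"
      using p[OF t] norm_triangle_ineq[of "p0 - integral {0..t} (\<lambda>s. f (q s))" "X t"]
        norm_triangle_ineq4[of p0 "integral {0..t} (\<lambda>s. f (q s))"] by simp
    also have "norm (integral {0..t} (\<lambda>s. f (q s))) \<le> integral {0..t} (\<lambda>s. norm (f (q s)))"
      using t by (intro integral_norm_bound_integral ii continuous_intros sub[OF cfq]) auto
    also have "\<dots> \<le> T * norm (f 0) + L * integral {0..t} g"
      using fqb[OF t] t mult_right_mono[of t T "norm (f 0)"] by simp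
    finally show "g t \<le> norm p0 + norm q0 + T * norm (f 0) + norm (X t) + (L + 1) * integral {0..t} g"
      using 1 by (simp add: g_def algebra_simps)
  qed (use T L in \<open>auto intro!: continuous_intros cg cX add_nonneg_nonneg\<close>)
  also have "integral {0..T} (\<lambda>t. (norm p0 + norm q0 + T * norm (f 0)) + norm (X t))
     = T * (norm p0 + norm q0 + T * norm (f 0)) + integral {0..T} (\<lambda>s. norm (X s))"
    using T by (subst integral_add) (auto intro!: ii continuous_intros cX)
  finally have gE: "integral {0..T} g \<le> E" by (simp add: E_def)
  have "integral {0..T} (\<lambda>s. norm (p s)) \<le> integral {0..T} g"
    by (intro integral_le ii continuous_intros cp cg) (auto simp: g_def)
  with gE show "integral {0..T} (\<lambda>s. norm (p s)) \<le> E" by simp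
  have "L * integral {0..T} g \<le> L * E" using gE L by (rule mult_left_mono)
  then show "integral {0..T} (\<lambda>s. norm (f (q s))) \<le> T * norm (f 0) + L * E"
    using fqb[of T] T by simp
qed

section \<open>Rescaling and splitting integrals along the time grid\<close>

lemma integral_unit_rescale:
  fixes f :: "real \<Rightarrow> 'v::euclidean_space"
  assumes h: "0 < h" and f: "continuous_on {a..a + h} f"
  shows "h *\<^sub>R integral {0..1} (\<lambda>s. f (a + s * h)) = integral {a..a + h} f"
proof -
  have "(f has_integral integral {a..a + h} f) (cbox a (a + h))"
    using f by (simp add: integrable_continuous_real integrable_integral)
  from has_integral_affinity[OF this, of h a] h
  have "((\<lambda>s. f (h * s + a)) has_integral (1 / h) *\<^sub>R integral {a..a + h} f)
      ((\<lambda>x. (1 / h) *\<^sub>R x + - ((1 / h) *\<^sub>R a)) ` cbox a (a + h))"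
    by simp
  also have "(\<lambda>x. (1 / h) *\<^sub>R x + - ((1 / h) *\<^sub>R a)) ` cbox a (a + h) = {0..1}"
    using h image_affinity_atLeastAtMost[of "1/h" "- a / h" a "a + h"]
    by (simp add: divide_simps)
  finally have "integral {0..1} (\<lambda>s. f (h * s + a)) = (1 / h) *\<^sub>R integral {a..a + h} f"
    by (rule integral_unique)
  with h show ?thesis by (simp add: algebra_simps)
qed

lemma integral_partition:
  fixes f :: "real \<Rightarrow> 'v::euclidean_space"
  assumes h: "0 \<le> h" and f: "continuous_on {0..real n * h} f"
  shows "(\<Sum>k<n. integral {real k * h..real (Suc k) * h} f) = integral {0..real n * h} f"
  using f
proof (induction n)
  case (Suc n)
  have 1: "real n * h \<le> real (Suc n) * h" using h by (simp add: mult_right_mono)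
  then have "(\<Sum>k<n. integral {real k * h..real (Suc k) * h} f) = integral {0..real n * h} f"
    using Suc by (intro Suc.IH) (auto intro: continuous_on_subset)
  moreover have "integral {0..real n * h} f + integral {real n * h..real (Suc n) * h} f
      = integral {0..real (Suc n) * h} f"
    using h 1 Suc.prems
    by (intro Henstock_Kurzweil_Integration.integral_combine integrable_continuous_real) auto
  ultimately show ?case by simp
qed simp

lemma norm_integral_le_const:
  fixes f :: "real \<Rightarrow> 'v::euclidean_space"
  assumes "a \<le> b" "continuous_on {a..b} f" "\<And>s. s \<in> {a..b} \<Longrightarrow> norm (f s) \<le> B"
  shows "norm (integral {a..b} f) \<le> (b - a) * B"
  using integral_bound[OF assms(1,2), of B] assms(3) by (simp add: mult.commute)

subsection \<open>Pathwise error of the scheme\<close>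

text \<open>Deterministic: \<open>X\<close> is any continuous path starting at 0. The restriction on
  \<open>h\<close> absorbs the current error, which reappears on the right because the stage depends
  on the new position. \<open>Z\<close> bounds \<open>h\<close> times the sum of the position errors
  over all \<open>N + 1\<close> grid points.\<close>

lemma scheme_error_bound:
  fixes f :: "'v::euclidean_space \<Rightarrow> 'v" and p q X :: "real \<Rightarrow> 'v" and P Q \<Psi> :: "nat \<Rightarrow> 'v"
  assumes lip: "L-lipschitz_on UNIV f"
    and h: "0 < h" "h \<le> 1" "4 * (L * (T + 1)) * h \<le> 1" and Nh: "real N * h = T"
    and cp: "continuous_on {0..T} p" and cq: "continuous_on {0..T} q"
    and cX: "continuous_on {0..T} X"
    and q: "\<And>t. t \<in> {0..T} \<Longrightarrow> q t = q0 + integral {0..t} p"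
    and p: "\<And>t. t \<in> {0..T} \<Longrightarrow> p t = p0 - integral {0..t} (\<lambda>s. f (q s)) + X t"
    and X0: "X 0 = 0" and P0: "P 0 = p0" and Q0: "Q 0 = q0"
    and I: "\<And>k. k < N \<Longrightarrow> I k = integral {0..1} (\<lambda>s. f (Q k + (s * h) *\<^sub>R \<Psi> (Suc k)))"
    and Psi: "\<And>k. k < N \<Longrightarrow>
      \<Psi> (Suc k) = P k + (X (real (Suc k) * h) - X (real k * h)) - (h / 2) *\<^sub>R I k"
    and QS: "\<And>k. k < N \<Longrightarrow> Q (Suc k) = Q k + h *\<^sub>R \<Psi> (Suc k)"
    and PS: "\<And>k. k < N \<Longrightarrow>
      P (Suc k) = P k + (X (real (Suc k) * h) - X (real k * h)) - h *\<^sub>R I k"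
    and n: "n \<le> N"
  defines "R \<equiv> \<lambda>n. h *\<^sub>R (\<Sum>k<n. X (real (Suc k) * h)) - integral {0..real n * h} X"
    and "A \<equiv> integral {0..T} (\<lambda>s. norm (p s))"
    and "B \<equiv> integral {0..T} (\<lambda>s. norm (f (q s)))"
    and "c \<equiv> L * (T + 1)"
  defines "Z \<equiv> h * (exp (4 * c * (T + 1)) *
      (2 * (\<Sum>k\<le>N. norm (R k)) + (T + 1) * (2 * c * A + 3 * B)))"
  shows "norm (q (real n * h) - Q n) \<le> 2 * norm (R n) + h * (2 * c * A + 3 * B) + 4 * c * Z"
    and "norm (p (real n * h) - P n) \<le> L * (h * A + 2 * Z)"
proof -
  have L: "L \<ge> 0" using lip by (rule lipschitz_on_nonneg)
  have T: "T \<ge> 0" using Nh h by auto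
  have c: "c \<ge> 0" using L T by (simp add: c_def)
  have cf: "continuous_on A f" for A
    using lipschitz_on_continuous_on[OF lip] by (rule continuous_on_subset) auto
  have cfq: "continuous_on {0..T} (\<lambda>s. f (q s))"
    by (rule continuous_on_compose2[OF cf[of UNIV] cq]) auto
  define t where "t k = real k * h" for k
  have t0: "t 0 = 0" by (simp add: t_def)
  have tS: "t (Suc k) = t k + h" for k by (simp add: t_def algebra_simps)
  have tN: "t k \<in> {0..T}" if "k \<le> N" for k
    using that h Nh by (auto simp: t_def mult_right_mono)
  have sub: "continuous_on {t k..t (Suc k)} w" if "continuous_on {0..T} w" "k < N"
    for w :: "real \<Rightarrow> 'w::euclidean_space" and k
  proof -
    have "{t k..t (Suc k)} \<subseteq> {0..T}" using tN[of k] tN[of "Suc k"] that by auto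
    then show ?thesis using that continuous_on_subset by blast
  qed
  note ii = integrable_continuous_real
  define e where "e k = norm (q (t k) - Q k)" for k
  define ep where "ep k = p (t k) - P k" for k
  define Y where "Y k s = Q k + (s - t k) *\<^sub>R \<Psi> (Suc k)" for k s
  define D where "D k = integral {t k..t (Suc k)} (\<lambda>s. norm (q s - Y k s))" for k
  define v where "v k = integral {t k..t (Suc k)} (\<lambda>s. norm (f (q s)))" for k
  define w where "w k = integral {t k..t (Suc k)} (\<lambda>s. norm (p s))" for k
  \<comment> \<open>The part of the quadrature error made in one step; \<open>R n\<close> is the sum
    of these. They are never estimated one by one, since their cancellation is what gives order
    \<open>h\<close>.\<close>
  define r where "r k = h *\<^sub>R X (t (Suc k)) - integral {t k..t (Suc k)} X" for k
  have cY: "continuous_on S (Y k)" for S k unfolding Y_def by (intro continuous_intros)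
  have cfY: "continuous_on S (\<lambda>s. f (Y k s))" for S k
    by (rule continuous_on_compose2[OF cf[of UNIV] cY]) auto
  have tle: "t k \<le> t (Suc k)" for k using h by (simp add: tS)
  have comb: "integral {0..u} g = integral {0..s} g + integral {s..u} g"
    if "continuous_on {0..T} g" "0 \<le> s" "s \<le> u" "u \<le> T" for g :: "real \<Rightarrow> 'v" and s u
    using that
    by (intro Henstock_Kurzweil_Integration.integral_combine[symmetric] ii)
      (auto intro: continuous_on_subset)
  have nle: "norm (integral {a..b} g) \<le> integral {t k..t (Suc k)} (\<lambda>s. norm (g s))"
    if "continuous_on {0..T} g" "k < N" "t k \<le> a" "a \<le> b" "b \<le> t (Suc k)"
    for g :: "real \<Rightarrow> 'v" and a b k
  proof -
    have s: "continuous_on {a..b} g"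
      using sub[OF that(1,2)] that by (auto intro: continuous_on_subset)
    have "norm (integral {a..b} g) \<le> integral {a..b} (\<lambda>s. norm (g s))"
      by (intro integral_norm_bound_integral ii continuous_intros s) auto
    also have "\<dots> \<le> integral {t k..t (Suc k)} (\<lambda>s. norm (g s))"
      using that by (intro integral_subset_le ii continuous_intros s sub) auto
    finally show ?thesis .
  qed
  have hI: "h *\<^sub>R I k = integral {t k..t (Suc k)} (\<lambda>s. f (Y k s))" if "k < N" for k
    using integral_unit_rescale[OF h(1) cfY[of "{t k..t k + h}" k]] I[OF that]
    by (simp add: Y_def tS)
  \<comment> \<open>This is claimed for every \<open>k\<close>, also past the grid where
    \<open>q\<close> need not be integrable; there the integral may take its default value
    0.\<close>
  have D0: "D k \<ge> 0" for k
    using not_integrable_integral[of "\<lambda>s. norm (q s - Y k s)"]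
      Henstock_Kurzweil_Integration.integral_nonneg[of "\<lambda>s. norm (q s - Y k s)"]
    unfolding D_def by (metis norm_ge_zero order_refl)
  \<comment> \<open>The stages \<open>Q k + s h \<Psi> (Suc k)\<close> run along the linear interpolation \<open>Y k\<close> of the numerical
    positions, so both the momentum and its approximation integrate the force along a path.\<close>
  have diff: "norm (integral {t k..t (Suc k)} (\<lambda>s. f (q s)) - h *\<^sub>R I k) \<le> L * D k"
    if k: "k < N" for k
  proof -
    have "integral {t k..t (Suc k)} (\<lambda>s. f (q s)) - h *\<^sub>R I k
        = integral {t k..t (Suc k)} (\<lambda>s. f (q s) - f (Y k s))"
      unfolding hI[OF k] by (intro Henstock_Kurzweil_Integration.integral_diff[symmetric] ii sub cfq cfY k)
    also have "norm \<dots> \<le> integral {t k..t (Suc k)} (\<lambda>s. L * norm (q s - Y k s))"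
      by (intro integral_norm_bound_integral ii continuous_intros sub cfq cq cfY cY k
          lipschitz_on_normD_UNIV[OF lip])
    finally show ?thesis by (simp add: D_def)
  qed
  \<comment> \<open>Solution and scheme receive the same noise increment, so it cancels and only the
    forces differ.\<close>
  have epS: "ep (Suc k) = ep k - (integral {t k..t (Suc k)} (\<lambda>s. f (q s)) - h *\<^sub>R I k)"
    if k: "k < N" for k
    using p[OF tN[of k]] p[OF tN[of "Suc k"]] comb[OF cfq, of "t k" "t (Suc k)"]
      PS[OF k, folded t_def] tN[of k] tN[of "Suc k"] tle[of k] k
    by (simp add: ep_def)
  have ep_le: "norm (ep k) \<le> L * (\<Sum>j<k. D j)" if "k \<le> N" for k
    using that
  proof (induction k)
    case 0
    then show ?case using p[of 0] T by (simp add: ep_def t0 P0 X0)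
  next
    case (Suc k)
    have "norm (ep (Suc k)) \<le> norm (ep k) + L * D k"
      using epS[of k] diff[of k] Suc.prems
        norm_triangle_ineq4[of "ep k" "integral {t k..t (Suc k)} (\<lambda>s. f (q s)) - h *\<^sub>R I k"]
      by simp
    then show ?case using Suc by (simp add: algebra_simps)
  qed
  \<comment> \<open>Expressed by the right endpoint, the scheme moves by
    \<open>h *\<^sub>R P (Suc k)\<close> plus \<open>(h / 2) *\<^sub>R (h *\<^sub>R I k)\<close>.
    For the solution, \<open>p s\<close> differs from its right endpoint value by a noise
    difference, which integrates to exactly \<open>- r k\<close>, and by a force integral of norm at
    most \<open>v k\<close>. The latter costs \<open>h * v k\<close>, the second term of the scheme
    \<open>h / 2 * (v k + L * D k)\<close>.\<close>
  have eqS: "norm (q (t (Suc k)) - Q (Suc k) - (q (t k) - Q k) - h *\<^sub>R ep (Suc k) + r k)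
      \<le> 3 / 2 * h * v k + h / 2 * (L * D k)" if k: "k < N" for k
  proof -
    let ?J = "integral {t k..t (Suc k)}"
    have ps: "p s = p (t (Suc k)) - X (t (Suc k)) + X s + integral {s..t (Suc k)} (\<lambda>s. f (q s))"
      if s: "s \<in> {t k..t (Suc k)}" for s
    proof -
      have "0 \<le> s" "s \<le> t (Suc k)" "t (Suc k) \<le> T"
        using s k tN[of k] tN[of "Suc k"] by auto
      then show ?thesis
        using p[of s] p[of "t (Suc k)"] comb[OF cfq, of s "t (Suc k)"] by simp
    qed
    have "q (t (Suc k)) = q (t k) + ?J p"
      using q[of "t k"] q[of "t (Suc k)"] comb[OF cp, of "t k" "t (Suc k)"]
        tN[of k] tN[of "Suc k"] tle[of k] k by simp
    moreover have "Q (Suc k) = Q k + h *\<^sub>R P (Suc k) + (h / 2) *\<^sub>R (h *\<^sub>R I k)"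
    proof -
      have "\<Psi> (Suc k) = P (Suc k) + (h / 2) *\<^sub>R I k"
        using Psi[OF k, folded t_def] PS[OF k, folded t_def] scaleR_left_distrib[of "h/2" "h/2" "I k"] by simp
      then show ?thesis using QS[OF k] by (simp add: scaleR_add_right)
    qed
    moreover have "?J p - h *\<^sub>R p (t (Suc k)) + r k
        = ?J (\<lambda>s. p s - (p (t (Suc k)) - X (t (Suc k)) + X s))"
    proof -
      have "?J (\<lambda>s. p s - (p (t (Suc k)) - X (t (Suc k)) + X s))
        = ?J p - ?J (\<lambda>s. p (t (Suc k)) - X (t (Suc k)) + X s)"
        by (intro Henstock_Kurzweil_Integration.integral_diff ii continuous_intros sub cp cX k)
      moreover have "?J (\<lambda>s. p (t (Suc k)) - X (t (Suc k)) + X s)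
        = ?J (\<lambda>s. p (t (Suc k)) - X (t (Suc k))) + ?J X"
        by (intro Henstock_Kurzweil_Integration.integral_add ii continuous_intros sub cX k)
      ultimately have "?J (\<lambda>s. p s - (p (t (Suc k)) - X (t (Suc k)) + X s))
        = ?J p - (?J (\<lambda>s. p (t (Suc k)) - X (t (Suc k))) + ?J X)"
        by simp
      then show ?thesis using h by (simp add: r_def tS algebra_simps)
    qed
    ultimately have eq: "q (t (Suc k)) - Q (Suc k) - (q (t k) - Q k) - h *\<^sub>R ep (Suc k) + r k
        = ?J (\<lambda>s. p s - (p (t (Suc k)) - X (t (Suc k)) + X s)) - (h / 2) *\<^sub>R (h *\<^sub>R I k)"
      by (simp add: ep_def algebra_simps)
    have "norm (?J (\<lambda>s. p s - (p (t (Suc k)) - X (t (Suc k)) + X s))) \<le> (t (Suc k) - t k) * v k"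
    proof (rule norm_integral_le_const[OF tle])
      fix s assume s: "s \<in> {t k..t (Suc k)}"
      then show "norm (p s - (p (t (Suc k)) - X (t (Suc k)) + X s)) \<le> v k"
        using ps[OF s] nle[OF cfq k, of s "t (Suc k)"] by (simp add: v_def)
    qed (intro continuous_intros sub cp cX k)
    then have 1: "norm (?J (\<lambda>s. p s - (p (t (Suc k)) - X (t (Suc k)) + X s))) \<le> h * v k"
      by (simp add: tS)
    have "norm (h *\<^sub>R I k) \<le> v k + L * D k"
      using diff[OF k] nle[OF cfq k, of "t k" "t (Suc k)"] tle[of k]
        norm_triangle_sub[of "h *\<^sub>R I k" "?J (\<lambda>s. f (q s))"]
      by (simp add: v_def norm_minus_commute)
    then have 2: "norm ((h / 2) *\<^sub>R (h *\<^sub>R I k)) \<le> h / 2 * (v k + L * D k)"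
      using h mult_left_mono[of "norm (h *\<^sub>R I k)" "v k + L * D k" "h / 2"]
      by (simp only: norm_scaleR) simp
    show ?thesis
      unfolding eq using norm_triangle_ineq4 1 2 by (rule order_trans[OF _ order_trans[OF add_mono]])
        (simp add: algebra_simps)
  qed
  have D_le: "D k \<le> h * (w k + e k + e (Suc k))" if k: "k < N" for k
  proof -
    have "norm (D k) \<le> (t (Suc k) - t k) * (w k + e k + e (Suc k))"
      unfolding D_def
    proof (rule norm_integral_le_const[OF tle])
      fix s assume s: "s \<in> {t k..t (Suc k)}"
      \<comment> \<open>\<open>Y k s\<close> is the convex combination of \<open>Q k\<close> and
        \<open>Q (Suc k)\<close> with weights \<open>1 - \<theta>\<close> and
        \<open>\<theta>\<close>. Splitting \<open>q s\<close> with the same weights leaves the two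
        endpoint errors and the motion of \<open>q\<close> within the step, at most
        \<open>w k\<close>; the stage \<open>\<Psi>\<close> disappears.\<close>
      define \<theta> where "\<theta> = (s - t k) / h"
      have \<theta>: "0 \<le> \<theta>" "\<theta> \<le> 1" "s - t k = \<theta> * h"
        using s h by (auto simp: \<theta>_def tS divide_simps)
      have bd: "0 \<le> t k" "t (Suc k) \<le> T" using tN[of k] tN[of "Suc k"] k by auto
      have a: "norm (q s - q (t k)) \<le> w k"
      proof -
        have "q s - q (t k) = integral {t k..s} p"
          using q[of s] q[of "t k"] comb[OF cp, of "t k" s] bd s by simp
        then show ?thesis using nle[OF cp k, of "t k" s] s by (simp add: w_def)
      qed
      have b: "norm (q s - q (t (Suc k))) \<le> w k"
      proof -
        have "q (t (Suc k)) - q s = integral {s..t (Suc k)} p"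
          using q[of s] q[of "t (Suc k)"] comb[OF cp, of s "t (Suc k)"] bd s by simp
        then show ?thesis
          using nle[OF cp k, of s "t (Suc k)"] s
          by (simp add: w_def norm_minus_commute[of "q s"])
      qed
      have "Y k s = (1 - \<theta>) *\<^sub>R Q k + \<theta> *\<^sub>R Q (Suc k)"
        by (simp add: Y_def \<theta>(3) QS[OF k] algebra_simps)
      then have "q s - Y k s = (1 - \<theta>) *\<^sub>R (q s - q (t k) + (q (t k) - Q k))
          + \<theta> *\<^sub>R (q s - q (t (Suc k)) + (q (t (Suc k)) - Q (Suc k)))"
        by (simp add: algebra_simps)
      also have "norm \<dots> \<le> (1 - \<theta>) * (w k + e k) + \<theta> * (w k + e (Suc k))"
      proof -
        have "norm (q s - q (t k) + (q (t k) - Q k)) \<le> w k + e k"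
          "norm (q s - q (t (Suc k)) + (q (t (Suc k)) - Q (Suc k))) \<le> w k + e (Suc k)"
          unfolding e_def by (rule norm_triangle_mono[OF a order_refl] norm_triangle_mono[OF b order_refl])+
        then show ?thesis
          using \<theta>(1,2)
          by (intro norm_triangle_le add_mono) (simp_all only: norm_scaleR, simp_all add: mult_left_mono)
      qed
      also have "\<dots> = w k + ((1 - \<theta>) * e k + \<theta> * e (Suc k))" by (simp add: algebra_simps)
      also have "\<dots> \<le> w k + (e k + e (Suc k))"
        using \<theta> by (intro add_left_mono add_mono mult_left_le_one_le) (auto simp: e_def)
      finally show "norm (norm (q s - Y k s)) \<le> w k + e k + e (Suc k)" by simp
    qed (intro continuous_intros sub cq cY k)
    then show ?thesis using D0[of k] by (simp add: tS)
  qed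
  have sumle: "(\<Sum>j<k. integral {t j..t (Suc j)} (\<lambda>s. norm (g s))) \<le> integral {0..T} (\<lambda>s. norm (g s))"
    if k: "k \<le> N" and g: "continuous_on {0..T} g" for g :: "real \<Rightarrow> 'v" and k
  proof -
    have s: "continuous_on {0..real k * h} g"
      using tN[OF k] by (intro continuous_on_subset[OF g]) (auto simp: t_def)
    have "(\<Sum>j<k. integral {t j..t (Suc j)} (\<lambda>s. norm (g s))) = integral {0..real k * h} (\<lambda>s. norm (g s))"
      unfolding t_def using h s by (intro integral_partition continuous_intros) auto
    also have "\<dots> \<le> integral {0..T} (\<lambda>s. norm (g s))"
      using tN[OF k] by (intro integral_subset_le ii continuous_intros s g) (auto simp: t_def)
    finally show ?thesis .
  qed
  have A0: "A \<ge> 0" unfolding A_def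
    by (intro Henstock_Kurzweil_Integration.integral_nonneg ii continuous_intros cp) auto
  have B0: "B \<ge> 0" unfolding B_def
    by (intro Henstock_Kurzweil_Integration.integral_nonneg ii continuous_intros cfq) auto
  have R: "R k = (\<Sum>j<k. r j)" if k: "k \<le> N" for k
  proof -
    have s: "continuous_on {0..real k * h} X"
      using tN[OF k] by (intro continuous_on_subset[OF cX]) (auto simp: t_def)
    show ?thesis
      using integral_partition[of h k X] h s
      by (simp add: R_def r_def t_def sum_subtractf scaleR_sum_right)
  qed
  \<comment> \<open>Shifting the index in the sum of \<open>e (Suc j)\<close> produces the boundary
    term \<open>h * e k\<close>, the trace of the implicitness of the scheme.\<close>
  have sumD: "(\<Sum>j<k. D j) \<le> h * A + 2 * h * (\<Sum>j<k. e j) + h * e k" if k: "k \<le> N" for k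
  proof -
    have "(\<Sum>j<k. D j) \<le> (\<Sum>j<k. h * (w j + e j + e (Suc j)))"
      using k by (intro sum_mono D_le) auto
    also have "\<dots> = h * ((\<Sum>j<k. w j) + (\<Sum>j<k. e j) + (\<Sum>j<k. e (Suc j)))"
      by (simp only: sum_distrib_left[symmetric] sum.distrib)
    also have "(\<Sum>j<k. e (Suc j)) = (\<Sum>j<k. e j) + e k - e 0"
      using sum.lessThan_Suc[of e k] sum.lessThan_Suc_shift[of e k] by simp
    also have "h * ((\<Sum>j<k. w j) + (\<Sum>j<k. e j) + ((\<Sum>j<k. e j) + e k - e 0))
      \<le> h * (A + (\<Sum>j<k. e j) + ((\<Sum>j<k. e j) + e k))"
      using h sumle[OF k cp] norm_ge_zero[of "q (t 0) - Q 0", folded e_def]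
      by (intro mult_left_mono) (auto simp: w_def A_def)
    finally show ?thesis by (simp add: algebra_simps)
  qed
  \<comment> \<open>Origin of \<open>c = L * (T + 1)\<close>: the momentum errors, each at most
    \<open>L\<close> times the sum of the \<open>D j\<close>, are summed with total weight
    \<open>k * h \<le> T\<close>, and the terms \<open>h / 2 * (L * D j)\<close> of the position
    steps contribute at most another \<open>L\<close>.\<close>
  have eq_le: "e k \<le> norm (R k) + 3 / 2 * h * B + c * (\<Sum>j<k. D j)" if k: "k \<le> N" for k
  proof -
    have *: "norm (q (t k) - Q k - (\<Sum>j<k. h *\<^sub>R ep (Suc j)) + R k)
        \<le> 3 / 2 * h * (\<Sum>j<k. v j) + h / 2 * (L * (\<Sum>j<k. D j))"
    proof -
      let ?g = "\<lambda>j. q (t (Suc j)) - Q (Suc j) - (q (t j) - Q j) - h *\<^sub>R ep (Suc j) + r j"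
      have "q (t k) - Q k = (\<Sum>j<k. q (t (Suc j)) - Q (Suc j) - (q (t j) - Q j))"
        using sum_lessThan_telescope[of "\<lambda>j. q (t j) - Q j" k] q[of 0] T by (simp add: t0 Q0)
      then have "q (t k) - Q k - (\<Sum>j<k. h *\<^sub>R ep (Suc j)) + R k = (\<Sum>j<k. ?g j)"
        by (simp only: R[OF k] sum_subtractf[symmetric] sum.distrib[symmetric])
      also have "norm \<dots> \<le> (\<Sum>j<k. 3 / 2 * h * v j + h / 2 * (L * D j))"
        using k by (intro sum_norm_le eqS) auto
      finally show ?thesis by (simp add: sum.distrib sum_distrib_left)
    qed
    have "norm (\<Sum>j<k. h *\<^sub>R ep (Suc j)) \<le> (\<Sum>j<k. h * (L * (\<Sum>i<k. D i)))"
    proof (rule sum_norm_le)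
      fix j assume j: "j \<in> {..<k}"
      have "norm (ep (Suc j)) \<le> L * (\<Sum>i<Suc j. D i)" using j k by (intro ep_le) auto
      also have "\<dots> \<le> L * (\<Sum>i<k. D i)"
        using j D0 L by (intro mult_left_mono sum_mono2) auto
      finally show "norm (h *\<^sub>R ep (Suc j)) \<le> h * (L * (\<Sum>i<k. D i))"
        using h by simp
    qed
    also have "\<dots> = t k * (L * (\<Sum>i<k. D i))" by (simp add: t_def)
    also have "\<dots> \<le> T * (L * (\<Sum>i<k. D i))"
      using tN[OF k] D0 L by (intro mult_right_mono mult_nonneg_nonneg sum_nonneg) auto
    finally have **: "norm (\<Sum>j<k. h *\<^sub>R ep (Suc j)) \<le> T * (L * (\<Sum>i<k. D i))" .
    have "e k \<le> norm (q (t k) - Q k - (\<Sum>j<k. h *\<^sub>R ep (Suc j)) + R k)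
        + norm (\<Sum>j<k. h *\<^sub>R ep (Suc j)) + norm (R k)"
      unfolding e_def
      using norm_triangle_ineq4[of "q (t k) - Q k - (\<Sum>j<k. h *\<^sub>R ep (Suc j)) + R k"
          "R k - (\<Sum>j<k. h *\<^sub>R ep (Suc j))"]
        norm_triangle_ineq4[of "R k" "\<Sum>j<k. h *\<^sub>R ep (Suc j)"]
      by (simp add: algebra_simps)
    moreover have "3 / 2 * h * (\<Sum>j<k. v j) \<le> 3 / 2 * h * B"
      using sumle[OF k cfq] h by (simp add: v_def B_def)
    moreover have "h / 2 * (L * (\<Sum>j<k. D j)) \<le> 1 * (L * (\<Sum>j<k. D j))"
      using h L D0 by (intro mult_right_mono mult_nonneg_nonneg sum_nonneg) auto
    ultimately show ?thesis using * ** by (simp add: c_def algebra_simps)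
  qed
  define b where "b k = 2 * norm (R k) + h * (2 * c * A + 3 * B)" for k
  have b0: "b k \<ge> 0" for k using c A0 B0 h by (auto simp: b_def)
  \<comment> \<open>By the step-size restriction \<open>c * h * e k\<close> is at most half of
    \<open>e k\<close> and moves to the left. Doubling what remains gives the factors 2, 3 and
    \<open>4 * c\<close>.\<close>
  have rec: "e k \<le> b k + 4 * c * h * (\<Sum>j<k. e j)" if k: "k \<le> N" for k
  proof -
    have "c * (\<Sum>j<k. D j) \<le> c * (h * A + 2 * h * (\<Sum>j<k. e j) + h * e k)"
      using sumD[OF k] c by (rule mult_left_mono)
    moreover have "c * (h * e k) \<le> 1 / 2 * e k"
    proof -
      have "c * h \<le> 1 / 2" "0 \<le> e k" using h(3) by (simp_all add: c_def e_def)
      then show ?thesis using mult_right_mono[of "c * h" "1 / 2" "e k"] by (simp add: mult.assoc)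
    qed
    ultimately show ?thesis using eq_le[OF k] by (simp add: b_def algebra_simps)
  qed
  \<comment> \<open>The last grid point is included, as the momentum bound at \<open>n = N\<close>
    needs it; \<open>h * (N + 1) = T + h\<close> explains \<open>T + 1\<close> in
    \<open>Z\<close>.\<close>
  have "(\<Sum>k<Suc N. e k) \<le> exp (4 * c * h * real (Suc N)) * (\<Sum>k<Suc N. b k)"
    using c h by (intro discrete_gronwall b0 rec) auto
  also have "4 * c * h * real (Suc N) = 4 * c * (T + h)" using Nh by (simp add: algebra_simps)
  also have "(\<Sum>k<Suc N. b k) = 2 * (\<Sum>k\<le>N. norm (R k)) + (T + h) * (2 * c * A + 3 * B)"
    unfolding b_def Nh[symmetric]
    by (simp add: sum.distrib sum_distrib_left lessThan_Suc_atMost algebra_simps)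
  also have "exp (4 * c * (T + h)) * (2 * (\<Sum>k\<le>N. norm (R k)) + (T + h) * (2 * c * A + 3 * B))
     \<le> exp (4 * c * (T + 1)) * (2 * (\<Sum>k\<le>N. norm (R k)) + (T + 1) * (2 * c * A + 3 * B))"
    using h c T A0 B0
    by (intro mult_mono add_left_mono mult_right_mono)
      (auto intro!: mult_left_mono sum_nonneg add_nonneg_nonneg)
  finally have hZ: "h * (\<Sum>k<Suc N. e k) \<le> Z"
    unfolding Z_def using h by (intro mult_left_mono) auto
  have Z: "h * (\<Sum>j<k. e j) \<le> Z" if "k \<le> Suc N" for k
  proof -
    have "h * (\<Sum>j<k. e j) \<le> h * (\<Sum>k<Suc N. e k)"
      using h that by (intro mult_left_mono sum_mono2) (auto simp: e_def)
    with hZ show ?thesis by (rule order_trans[rotated])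
  qed
  have "e n \<le> b n + 4 * c * (h * (\<Sum>j<n. e j))"
    using rec[OF n] by (simp add: algebra_simps)
  also have "\<dots> \<le> b n + 4 * c * Z"
    using Z[of n] n c by (intro add_left_mono mult_left_mono) auto
  finally show "norm (q (real n * h) - Q n) \<le> 2 * norm (R n) + h * (2 * c * A + 3 * B) + 4 * c * Z"
    by (simp add: b_def e_def t_def)
  \<comment> \<open>The boundary term \<open>h * e n\<close> is merged into one of the two sums, so
    that both are covered by \<open>Z\<close>.\<close>
  have "(\<Sum>j<n. D j) \<le> h * A + h * (\<Sum>j<n. e j) + h * (\<Sum>j<Suc n. e j)"
    using sumD[OF n] by (simp add: algebra_simps)
  also have "\<dots> \<le> h * A + 2 * Z" using Z[of n] Z[of "Suc n"] n by simp
  finally have "L * (\<Sum>j<n. D j) \<le> L * (h * A + 2 * Z)" using L by (rule mult_left_mono)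
  then show "norm (p (real n * h) - P n) \<le> L * (h * A + 2 * Z)"
    using ep_le[OF n] by (simp add: ep_def t_def)
qed

subsection \<open>Square-integrable functionals of the noise\<close>

text \<open>An L2 norm bound that carries measurability and integrability along, so that each rule
  below transports all three. Without integrability the bound would be void, because the integral
  would default to 0.\<close>

definition l2_le :: "'a measure \<Rightarrow> ('a \<Rightarrow> real) \<Rightarrow> real \<Rightarrow> bool" where
  "l2_le M Z a \<longleftrightarrow> Z \<in> borel_measurable M \<and> integrable M (\<lambda>\<omega>. (Z \<omega>)\<^sup>2) \<and> (\<integral>\<omega>. (Z \<omega>)\<^sup>2 \<partial>M) \<le> a\<^sup>2"

lemma l2_le_cmult: "l2_le M Z a \<Longrightarrow> l2_le M (\<lambda>\<omega>. c * Z \<omega>) (c * a)"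
  by (auto simp: l2_le_def power_mult_distrib intro!: mult_left_mono)

lemma l2_le_abs: "l2_le M Z a \<Longrightarrow> l2_le M (\<lambda>\<omega>. \<bar>Z \<omega>\<bar>) a"
  by (auto simp: l2_le_def)

lemma l2_le_mono: "l2_le M Z a \<Longrightarrow> 0 \<le> a \<Longrightarrow> a \<le> b \<Longrightarrow> l2_le M Z b"
  unfolding l2_le_def by (meson order_trans power_mono)

lemma l2_le_dominated:
  assumes "l2_le M Z a" and [measurable]: "Y \<in> borel_measurable M"
    and le: "AE \<omega> in M. \<bar>Y \<omega>\<bar> \<le> Z \<omega>"
  shows "l2_le M Y a"
proof -
  have Z: "integrable M (\<lambda>\<omega>. (Z \<omega>)\<^sup>2)" "(\<integral>\<omega>. (Z \<omega>)\<^sup>2 \<partial>M) \<le> a\<^sup>2"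
    using assms(1) by (auto simp: l2_le_def)
  have ae: "AE \<omega> in M. (Y \<omega>)\<^sup>2 \<le> (Z \<omega>)\<^sup>2"
    using le by eventually_elim (metis abs_ge_zero power2_abs power_mono)
  have Y: "integrable M (\<lambda>\<omega>. (Y \<omega>)\<^sup>2)"
    by (rule Bochner_Integration.integrable_bound[OF Z(1)]) (use ae in auto)
  from integral_mono_AE[OF Y Z(1) ae] Y Z(2) show ?thesis
    by (auto simp: l2_le_def)
qed

text \<open>Minkowski's inequality by Young's inequality with weights adapted to the bounds, so that
  the result is exactly \<open>(a + b)\<^sup>2\<close>. The quotients require strictly positive
  bounds, which is why later constants are enlarged by 1.\<close>

lemma l2_le_add:
  assumes Y: "l2_le M Y a" and Z: "l2_le M Z b" and ab: "0 < a" "0 < b"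
  shows "l2_le M (\<lambda>\<omega>. Y \<omega> + Z \<omega>) (a + b)"
proof -
  have [measurable]: "Y \<in> borel_measurable M" "Z \<in> borel_measurable M"
    and iY: "integrable M (\<lambda>\<omega>. (Y \<omega>)\<^sup>2)" "(\<integral>\<omega>. (Y \<omega>)\<^sup>2 \<partial>M) \<le> a\<^sup>2"
    and iZ: "integrable M (\<lambda>\<omega>. (Z \<omega>)\<^sup>2)" "(\<integral>\<omega>. (Z \<omega>)\<^sup>2 \<partial>M) \<le> b\<^sup>2"
    using Y Z by (auto simp: l2_le_def)
  let ?g = "\<lambda>\<omega>. (1 + b / a) * (Y \<omega>)\<^sup>2 + (1 + a / b) * (Z \<omega>)\<^sup>2"
  have young: "(y + z)\<^sup>2 \<le> (1 + b / a) * y\<^sup>2 + (1 + a / b) * z\<^sup>2" for y z :: real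
  proof -
    have "0 \<le> (b * y - a * z)\<^sup>2 / (a * b)" using ab by simp
    also have "\<dots> = b / a * y\<^sup>2 + a / b * z\<^sup>2 - 2 * y * z"
      using ab by (simp add: field_simps power2_eq_square)
    finally show ?thesis by (simp add: power2_sum algebra_simps)
  qed
  have ig: "integrable M ?g" using iY iZ by simp
  have i: "integrable M (\<lambda>\<omega>. (Y \<omega> + Z \<omega>)\<^sup>2)"
    by (rule Bochner_Integration.integrable_bound[OF ig])
      (use young in \<open>auto intro!: AE_I2 order_trans[OF _ abs_ge_self]\<close>)
  have "(\<integral>\<omega>. (Y \<omega> + Z \<omega>)\<^sup>2 \<partial>M) \<le> (\<integral>\<omega>. ?g \<omega> \<partial>M)"
    by (intro integral_mono i ig young)
  also have "\<dots> = (1 + b / a) * (\<integral>\<omega>. (Y \<omega>)\<^sup>2 \<partial>M) + (1 + a / b) * (\<integral>\<omega>. (Z \<omega>)\<^sup>2 \<partial>M)"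
    using iY iZ by simp
  also have "\<dots> \<le> (1 + b / a) * a\<^sup>2 + (1 + a / b) * b\<^sup>2"
    using iY iZ ab by (intro add_mono mult_left_mono) auto
  also have "\<dots> = (a + b)\<^sup>2" using ab by (simp add: field_simps power2_eq_square)
  finally show ?thesis using i by (simp add: l2_le_def)
qed

lemma l2_le_sum:
  assumes "finite I" "I \<noteq> {}" "\<And>i. i \<in> I \<Longrightarrow> l2_le M (Z i) (a i)" "\<And>i. i \<in> I \<Longrightarrow> 0 < a i"
  shows "l2_le M (\<lambda>\<omega>. \<Sum>i\<in>I. Z i \<omega>) (\<Sum>i\<in>I. a i)"
  using assms
proof (induction I rule: finite_ne_induct)
  case (insert i I)
  then show ?case using l2_le_add[of M "Z i" "a i" "\<lambda>\<omega>. \<Sum>i\<in>I. Z i \<omega>" "\<Sum>i\<in>I. a i"]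
    by (simp add: sum_pos)
qed simp

text \<open>Fatou's lemma. Applied to Riemann sums, it yields both the measurability and the L2
  bound of time integrals of the noise.\<close>

lemma l2_le_LIMSEQ:
  assumes Z: "\<And>m. l2_le M (Z m) a"
    and lim: "\<And>\<omega>. \<omega> \<in> space M \<Longrightarrow> (\<lambda>m. Z m \<omega>) \<longlonglongrightarrow> Y \<omega>"
  shows "l2_le M Y a"
proof -
  have [measurable]: "Z m \<in> borel_measurable M" for m using Z by (simp add: l2_le_def)
  have Y[measurable]: "Y \<in> borel_measurable M"
    by (rule borel_measurable_LIMSEQ_real[where u = Z]) (use lim in auto)
  have "(\<integral>\<^sup>+\<omega>. ennreal ((Y \<omega>)\<^sup>2) \<partial>M) = (\<integral>\<^sup>+\<omega>. liminf (\<lambda>m. ennreal ((Z m \<omega>)\<^sup>2)) \<partial>M)"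
  proof (rule nn_integral_cong)
    fix \<omega> assume "\<omega> \<in> space M"
    then have "(\<lambda>m. ennreal ((Z m \<omega>)\<^sup>2)) \<longlonglongrightarrow> ennreal ((Y \<omega>)\<^sup>2)"
      by (intro tendsto_ennrealI tendsto_power lim)
    then show "ennreal ((Y \<omega>)\<^sup>2) = liminf (\<lambda>m. ennreal ((Z m \<omega>)\<^sup>2))"
      by (rule lim_imp_Liminf[OF trivial_limit_sequentially, symmetric])
  qed
  also have "\<dots> \<le> liminf (\<lambda>m. \<integral>\<^sup>+\<omega>. ennreal ((Z m \<omega>)\<^sup>2) \<partial>M)"
    by (rule nn_integral_liminf) auto
  also have "\<dots> \<le> liminf (\<lambda>m::nat. ennreal (a\<^sup>2))"
  proof (intro Liminf_mono always_eventually allI)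
    fix m
    show "(\<integral>\<^sup>+\<omega>. ennreal ((Z m \<omega>)\<^sup>2) \<partial>M) \<le> ennreal (a\<^sup>2)"
      using Z[of m] by (subst nn_integral_eq_integral) (auto simp: l2_le_def intro!: ennreal_leI)
  qed
  also have "\<dots> = ennreal (a\<^sup>2)" by (simp add: Liminf_const)
  finally have le: "(\<integral>\<^sup>+\<omega>. ennreal ((Y \<omega>)\<^sup>2) \<partial>M) \<le> ennreal (a\<^sup>2)" .
  have i: "integrable M (\<lambda>\<omega>. (Y \<omega>)\<^sup>2)"
    using le by (intro integrableI_bounded) (auto simp: le_less_trans[OF _ ennreal_less_top])
  moreover have "(\<integral>\<omega>. (Y \<omega>)\<^sup>2 \<partial>M) \<le> a\<^sup>2"
    using le by (subst (asm) nn_integral_eq_integral[OF i]) auto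
  ultimately show ?thesis by (simp add: l2_le_def)
qed

section \<open>Riemann sums on refinements of the time grid and summation by parts\<close>

lemma riemann_sum_tendsto_integral:
  fixes f :: "real \<Rightarrow> real"
  assumes h: "0 < h" and f: "continuous_on {0..real n * h} f"
  shows "(\<lambda>m. h / real (Suc m) * (\<Sum>j<n * Suc m. f (real j * (h / real (Suc m)))))
     \<longlonglongrightarrow> integral {0..real n * h} f"
proof (rule LIMSEQ_I)
  fix r :: real assume r: "0 < r"
  \<comment> \<open>A deviation \<open>e\<close> accumulated over the length \<open>n * h\<close>
    stays below \<open>r\<close>; the summand 1 covers \<open>n = 0\<close>.\<close>
  define e where "e = r / (2 * (real n * h + 1))"
  have nh: "0 \<le> real n * h" using h by simp
  have e: "0 < e" "e * (real n * h) < r"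
  proof -
    have "0 < 2 * (y + 1)" "y < 2 * (y + 1)" if "0 \<le> y" for y :: real
      using that by simp_all
    note * = this[OF nh]
    show "0 < e" unfolding e_def using r *(1) by (rule divide_pos_pos)
    have "r * (real n * h) < r * (2 * (real n * h + 1))"
      using *(2) r by (rule mult_strict_left_mono)
    then show "e * (real n * h) < r"
      unfolding e_def times_divide_eq_left using *(1) by (simp only: pos_divide_less_eq)
  qed
  have "uniformly_continuous_on {0..real n * h} f"
    using f by (intro compact_uniformly_continuous) auto
  then obtain d where d: "0 < d"
    "\<And>x y. x \<in> {0..real n * h} \<Longrightarrow> y \<in> {0..real n * h} \<Longrightarrow> dist y x < d \<Longrightarrow> dist (f y) (f x) < e"
    using e unfolding uniformly_continuous_on_def by metis
  have "(\<lambda>m. h / real (Suc m)) \<longlonglongrightarrow> 0" by (rule LIMSEQ_Suc[OF lim_const_over_n])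
  then obtain m0 where m0: "\<And>m. m \<ge> m0 \<Longrightarrow> \<bar>h / real (Suc m)\<bar> < d"
    using d(1) LIMSEQ_D[of "\<lambda>m. h / real (Suc m)" 0 d] by auto
  show "\<exists>no. \<forall>m\<ge>no. norm (h / real (Suc m) * (\<Sum>j<n * Suc m. f (real j * (h / real (Suc m))))
      - integral {0..real n * h} f) < r"
  proof (intro exI allI impI)
    fix m assume m: "m \<ge> m0"
    define \<delta> where "\<delta> = h / real (Suc m)"
    have \<delta>: "0 < \<delta>" "\<delta> < d" using m0[OF m] h by (auto simp: \<delta>_def)
    have nd: "real (n * Suc m) * \<delta> = real n * h" by (simp add: \<delta>_def field_simps)
    have piece: "norm (\<delta> * f (real j * \<delta>) - integral {real j * \<delta>..real (Suc j) * \<delta>} f) \<le> \<delta> * e"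
      if j: "j < n * Suc m" for j
    proof -
      have a: "real (Suc j) * \<delta> \<le> real n * h" "real j * \<delta> \<le> real (Suc j) * \<delta>" "0 \<le> real j * \<delta>"
        unfolding nd[symmetric] using j \<delta> by (auto intro!: mult_right_mono simp del: of_nat_mult)
      have c: "continuous_on {real j * \<delta>..real (Suc j) * \<delta>} f"
        using a by (intro continuous_on_subset[OF f]) auto
      have "integral {real j * \<delta>..real (Suc j) * \<delta>} (\<lambda>s. f (real j * \<delta>) - f s)
         = integral {real j * \<delta>..real (Suc j) * \<delta>} (\<lambda>s. f (real j * \<delta>))
          - integral {real j * \<delta>..real (Suc j) * \<delta>} f"
        by (intro Henstock_Kurzweil_Integration.integral_diff integrable_continuous_real
            continuous_intros c)
      also have "integral {real j * \<delta>..real (Suc j) * \<delta>} (\<lambda>s. f (real j * \<delta>)) = \<delta> * f (real j * \<delta>)"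
        using a by (simp add: algebra_simps)
      finally have eq: "\<delta> * f (real j * \<delta>) - integral {real j * \<delta>..real (Suc j) * \<delta>} f
        = integral {real j * \<delta>..real (Suc j) * \<delta>} (\<lambda>s. f (real j * \<delta>) - f s)" by simp
      have "norm (integral {real j * \<delta>..real (Suc j) * \<delta>} (\<lambda>s. f (real j * \<delta>) - f s))
        \<le> (real (Suc j) * \<delta> - real j * \<delta>) * e"
      proof (rule norm_integral_le_const[OF a(2)])
        fix s assume s: "s \<in> {real j * \<delta>..real (Suc j) * \<delta>}"
        have "dist (real j * \<delta>) s < d" using s \<delta> by (auto simp: dist_real_def algebra_simps)
        then show "norm (f (real j * \<delta>) - f s) \<le> e"
          using d(2)[of s "real j * \<delta>"] s a by (auto simp: dist_norm)
      qed (intro continuous_intros c)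
      then show ?thesis unfolding eq by (simp add: algebra_simps)
    qed
    have "integral {0..real n * h} f = (\<Sum>j<n * Suc m. integral {real j * \<delta>..real (Suc j) * \<delta>} f)"
      using integral_partition[of \<delta> "n * Suc m" f] \<delta> f unfolding nd by simp
    then have "\<delta> * (\<Sum>j<n * Suc m. f (real j * \<delta>)) - integral {0..real n * h} f
      = (\<Sum>j<n * Suc m. \<delta> * f (real j * \<delta>) - integral {real j * \<delta>..real (Suc j) * \<delta>} f)"
      by (simp only: sum_subtractf sum_distrib_left)
    also have "norm \<dots> \<le> (\<Sum>j<n * Suc m. \<delta> * e)" by (intro sum_norm_le piece) auto
    also have "\<dots> = e * (real n * h)" unfolding nd[symmetric] by simp
    also have "\<dots> < r" by (rule e)
    finally show "norm (h / real (Suc m) * (\<Sum>j<n * Suc m. f (real j * (h / real (Suc m))))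
      - integral {0..real n * h} f) < r" by (simp only: \<delta>_def)
  qed
qed

text \<open>Summation by parts in each block of \<open>m\<close> fine points: the difference between
  the end of the block and its left endpoints counts the increment at position \<open>i\<close> once
  for each left endpoint at or before it, hence \<open>i + 1\<close> times.\<close>

lemma weighted_increments_eq:
  fixes x :: "nat \<Rightarrow> real"
  shows "(\<Sum>j<n * m. (real (j mod m) + 1) * (x (Suc j) - x j))
    = real m * (\<Sum>k<n. x (Suc k * m)) - (\<Sum>j<n * m. x j)"
proof -
  have block: "(\<Sum>i<m. (real i + 1) * (y (Suc i) - y i)) = real m * y m - (\<Sum>i<m. y i)"
    for y :: "nat \<Rightarrow> real" and m
    by (induction m) (simp_all add: algebra_simps)
  have sh: "sum g {k * m..<k * m + m} = (\<Sum>i<m. g (k * m + i))" for g :: "nat \<Rightarrow> real" and k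
    using sum.shift_bounds_nat_ivl[of g 0 "k * m" m] by (simp add: atLeast0LessThan add.commute)
  have "(\<Sum>j<n * m. (real (j mod m) + 1) * (x (Suc j) - x j))
     = (\<Sum>k<n. \<Sum>i<m. (real i + 1) * (x (Suc (k * m + i)) - x (k * m + i)))"
    unfolding sum.nat_group[symmetric] sh by (intro sum.cong) auto
  also have "\<dots> = (\<Sum>k<n. real m * x (Suc k * m) - (\<Sum>i<m. x (k * m + i)))"
  proof (intro sum.cong refl)
    fix k
    show "(\<Sum>i<m. (real i + 1) * (x (Suc (k * m + i)) - x (k * m + i)))
      = real m * x (Suc k * m) - (\<Sum>i<m. x (k * m + i))"
      using block[where y = "\<lambda>i. x (k * m + i)" and m = m] by (simp add: add.commute)
  qed
  also have "\<dots> = real m * (\<Sum>k<n. x (Suc k * m)) - (\<Sum>j<n * m. x j)"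
    unfolding sum.nat_group[symmetric] sh by (simp add: sum_subtractf sum_distrib_left)
  finally show ?thesis .
qed

text \<open>The second-order properties of a scalar Brownian path on which the mean-square estimates
  rest.\<close>

locale orthogonal_increments = prob_space M for M :: "'a measure" +
  fixes T :: real and B :: "real \<Rightarrow> 'a \<Rightarrow> real"
  assumes measurable_B: "t \<in> {0..T} \<Longrightarrow> B t \<in> borel_measurable M"
    and continuous_B: "\<omega> \<in> space M \<Longrightarrow> continuous_on {0..T} (\<lambda>t. B t \<omega>)"
    and variance_B: "0 \<le> s \<Longrightarrow> s < t \<Longrightarrow> t \<le> T \<Longrightarrow>
      integrable M (\<lambda>\<omega>. (B t \<omega> - B s \<omega>)\<^sup>2) \<and> (\<integral>\<omega>. (B t \<omega> - B s \<omega>)\<^sup>2 \<partial>M) = t - s"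
    and orthogonal_B: "0 \<le> s \<Longrightarrow> s < t \<Longrightarrow> t \<le> u \<Longrightarrow> u < v \<Longrightarrow> v \<le> T \<Longrightarrow>
      (\<integral>\<omega>. (B t \<omega> - B s \<omega>) * (B v \<omega> - B u \<omega>) \<partial>M) = 0"
begin

text \<open>Pythagoras: the cross terms vanish, so the second moment is the sum of the
  \<open>(c j)\<^sup>2 * \<delta>\<close>, at most \<open>K\<^sup>2 * T\<close> however many
  increments there are.\<close>

lemma l2_weighted_increments:
  fixes c :: "nat \<Rightarrow> real"
  assumes \<delta>: "0 < \<delta>" "real n * \<delta> \<le> T" and c: "\<And>j. j < n \<Longrightarrow> \<bar>c j\<bar> \<le> K"
  shows "l2_le M (\<lambda>\<omega>. \<Sum>j<n. c j * (B (real (Suc j) * \<delta>) \<omega> - B (real j * \<delta>) \<omega>)) (K * sqrt T)"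
proof -
  define X where "X j \<omega> = B (real (Suc j) * \<delta>) \<omega> - B (real j * \<delta>) \<omega>" for j \<omega>
  have T: "T \<ge> 0" using \<delta> by (meson le_less mult_nonneg_nonneg of_nat_0_le_iff order_trans)
  have le: "real i * \<delta> \<le> real j * \<delta>" if "i \<le> j" for i j using that \<delta> by (simp add: mult_right_mono)
  have leT: "real (Suc j) * \<delta> \<le> T" if "j < n" for j
    using that by (intro order_trans[OF le \<delta>(2)]) simp
  have less: "real j * \<delta> < real (Suc j) * \<delta>" for j using \<delta> by simp
  have nn: "0 \<le> real j * \<delta>" for j using \<delta> by simp
  have X[measurable]: "X j \<in> borel_measurable M" if "j < n" for j
    using measurable_B[of "real j * \<delta>"] measurable_B[of "real (Suc j) * \<delta>"] leT[OF that] less[of j] nn[of j]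
    unfolding X_def by (auto intro!: borel_measurable_diff)
  have v: "integrable M (\<lambda>\<omega>. (X j \<omega>)\<^sup>2)" "(\<integral>\<omega>. (X j \<omega>)\<^sup>2 \<partial>M) = \<delta>" if "j < n" for j
    using variance_B[OF nn less leT[OF that]] by (auto simp: X_def algebra_simps)
  have ip: "integrable M (\<lambda>\<omega>. X i \<omega> * X j \<omega>)" if "i < n" "j < n" for i j
  proof (rule Bochner_Integration.integrable_bound)
    show "integrable M (\<lambda>\<omega>. (X i \<omega>)\<^sup>2 + (X j \<omega>)\<^sup>2)" using v that by simp
    show "(\<lambda>\<omega>. X i \<omega> * X j \<omega>) \<in> borel_measurable M" using X that by simp
    have "\<bar>x * y\<bar> \<le> x\<^sup>2 + y\<^sup>2" for x y :: real
    proof -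
      have "2 * (\<bar>x\<bar> * \<bar>y\<bar>) \<le> x\<^sup>2 + y\<^sup>2" using sum_squares_bound[of "\<bar>x\<bar>" "\<bar>y\<bar>"] by simp
      moreover have "0 \<le> \<bar>x\<bar> * \<bar>y\<bar>" by simp
      ultimately show ?thesis unfolding abs_mult by linarith
    qed
    then show "AE \<omega> in M. norm (X i \<omega> * X j \<omega>) \<le> norm ((X i \<omega>)\<^sup>2 + (X j \<omega>)\<^sup>2)" by simp
  qed
  have cross: "(\<integral>\<omega>. X i \<omega> * X j \<omega> \<partial>M) = (if i = j then \<delta> else 0)" if "i < n" "j < n" for i j
  proof -
    have *: "(\<integral>\<omega>. X i \<omega> * X j \<omega> \<partial>M) = 0" if "i < j" "j < n" for i j
      using orthogonal_B[OF nn less le less leT, of i j] that by (simp add: X_def)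
    show ?thesis
      using *[of i j] *[of j i] that v[of i] by (cases i j rule: linorder_cases)
        (auto simp: power2_eq_square mult.commute)
  qed
  have sq: "(\<Sum>j<n. c j * X j \<omega>)\<^sup>2 = (\<Sum>i<n. \<Sum>j<n. c i * c j * (X i \<omega> * X j \<omega>))" for \<omega>
    by (simp add: power2_eq_square sum_product algebra_simps)
  have "(\<integral>\<omega>. (\<Sum>j<n. c j * X j \<omega>)\<^sup>2 \<partial>M) = (\<Sum>i<n. \<Sum>j<n. c i * c j * (\<integral>\<omega>. X i \<omega> * X j \<omega> \<partial>M))"
    unfolding sq
    by (subst Bochner_Integration.integral_sum sum.cong,
        auto intro!: sum.cong Bochner_Integration.integrable_sum ip simp: Bochner_Integration.integral_sum ip)
  also have "\<dots> = (\<Sum>i<n. (c i)\<^sup>2 * \<delta>)"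
  proof (intro sum.cong refl)
    fix i assume i: "i \<in> {..<n}"
    then have "(\<Sum>j<n. c i * c j * (\<integral>\<omega>. X i \<omega> * X j \<omega> \<partial>M)) = (\<Sum>j<n. if j = i then c i * c j * \<delta> else 0)"
      by (intro sum.cong refl) (simp add: cross)
    also have "\<dots> = (c i)\<^sup>2 * \<delta>" using i by (simp add: power2_eq_square)
    finally show "(\<Sum>j<n. c i * c j * (\<integral>\<omega>. X i \<omega> * X j \<omega> \<partial>M)) = (c i)\<^sup>2 * \<delta>" .
  qed
  also have "\<dots> \<le> (\<Sum>i<n. K\<^sup>2 * \<delta>)"
  proof (intro sum_mono mult_right_mono)
    fix i assume "i \<in> {..<n}"
    then show "(c i)\<^sup>2 \<le> K\<^sup>2" using c[of i] power_mono[of "\<bar>c i\<bar>" K 2] by simp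
  qed (use \<delta> in auto)
  also have "\<dots> = K\<^sup>2 * (real n * \<delta>)" by simp
  also have "\<dots> \<le> (K * sqrt T)\<^sup>2" using \<delta> T by (simp add: power_mult_distrib mult_left_mono)
  finally have "(\<integral>\<omega>. (\<Sum>j<n. c j * X j \<omega>)\<^sup>2 \<partial>M) \<le> (K * sqrt T)\<^sup>2" .
  moreover have "integrable M (\<lambda>\<omega>. (\<Sum>j<n. c j * X j \<omega>)\<^sup>2)"
    unfolding sq by (auto intro!: Bochner_Integration.integrable_sum ip)
  moreover have "(\<lambda>\<omega>. \<Sum>j<n. c j * X j \<omega>) \<in> borel_measurable M"
    using X by simp
  ultimately show ?thesis by (simp add: l2_le_def X_def)
qed

text \<open>The quadrature error is of order \<open>h\<close>, not \<open>sqrt h\<close>: on a subgrid of mesh \<open>\<delta>\<close> it is a sum of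
  increments weighted by the distance to the preceding multiple of \<open>h\<close>, and the increments are orthogonal.
  Passing to the limit by Fatou's lemma avoids stochastic integrals.\<close>

lemma l2_quadrature_error:
  assumes h: "0 < h" "real n * h \<le> T"
  shows "l2_le M (\<lambda>\<omega>. h * (\<Sum>k<n. B (real (Suc k) * h) \<omega>) - integral {0..real n * h} (\<lambda>s. B s \<omega>)) (h * sqrt T)"
proof (rule l2_le_LIMSEQ)
  fix m :: nat
  define \<delta> where "\<delta> = h / real (Suc m)"
  have \<delta>: "0 < \<delta>" "\<delta> * real (Suc m) = h" using h by (auto simp: \<delta>_def)
  \<comment> \<open>No weight exceeds \<open>\<delta> * real (Suc m) = h\<close>, so the bound does
    not depend on \<open>m\<close>, as the passage to the limit demands.\<close>
  have "l2_le M (\<lambda>\<omega>. \<Sum>j<n * Suc m. (\<delta> * (real (j mod Suc m) + 1)) *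
      (B (real (Suc j) * \<delta>) \<omega> - B (real j * \<delta>) \<omega>)) (h * sqrt T)"
  proof (rule l2_weighted_increments)
    have "real (n * Suc m) * \<delta> = real n * h" using \<delta>(2) by (metis mult.assoc mult.commute of_nat_mult)
    then show "real (n * Suc m) * \<delta> \<le> T" using h by simp
    fix j
    have "j mod Suc m < Suc m" by simp
    then have "real (j mod Suc m) + 1 \<le> real (Suc m)" by linarith
    then have "\<delta> * (real (j mod Suc m) + 1) \<le> h" using \<delta> mult_left_mono[of _ _ \<delta>] by fastforce
    then show "\<bar>\<delta> * (real (j mod Suc m) + 1)\<bar> \<le> h" using \<delta> by simp
  qed (use \<delta> in simp)
  also have "(\<lambda>\<omega>. \<Sum>j<n * Suc m. (\<delta> * (real (j mod Suc m) + 1)) *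
      (B (real (Suc j) * \<delta>) \<omega> - B (real j * \<delta>) \<omega>))
    = (\<lambda>\<omega>. h * (\<Sum>k<n. B (real (Suc k) * h) \<omega>) - \<delta> * (\<Sum>j<n * Suc m. B (real j * \<delta>) \<omega>))"
  proof
    fix \<omega>
    \<comment> \<open>Every coarse grid point is also a fine one, so the block ends of the summation
      by parts are the nodes of the quadrature.\<close>
    have e: "real (Suc k * Suc m) * \<delta> = real (Suc k) * h" for k
      using \<delta>(2) by (metis mult.assoc mult.commute of_nat_mult)
    have "(\<Sum>j<n * Suc m. (\<delta> * (real (j mod Suc m) + 1)) * (B (real (Suc j) * \<delta>) \<omega> - B (real j * \<delta>) \<omega>))
      = \<delta> * (\<Sum>j<n * Suc m. (real (j mod Suc m) + 1) * (B (real (Suc j) * \<delta>) \<omega> - B (real j * \<delta>) \<omega>))"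
      by (simp only: sum_distrib_left mult.assoc)
    also have "\<dots> = \<delta> * (real (Suc m) * (\<Sum>k<n. B (real (Suc k) * h) \<omega>) - (\<Sum>j<n * Suc m. B (real j * \<delta>) \<omega>))"
      by (simp only: weighted_increments_eq[where n = n and m = "Suc m" and x = "\<lambda>j. B (real j * \<delta>) \<omega>"] e)
    also have "\<dots> = h * (\<Sum>k<n. B (real (Suc k) * h) \<omega>) - \<delta> * (\<Sum>j<n * Suc m. B (real j * \<delta>) \<omega>)"
      by (simp only: right_diff_distrib mult.assoc[symmetric] \<delta>(2))
    finally show "(\<Sum>j<n * Suc m. (\<delta> * (real (j mod Suc m) + 1)) * (B (real (Suc j) * \<delta>) \<omega> - B (real j * \<delta>) \<omega>))
      = h * (\<Sum>k<n. B (real (Suc k) * h) \<omega>) - \<delta> * (\<Sum>j<n * Suc m. B (real j * \<delta>) \<omega>)" .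
  qed
  finally show "l2_le M (\<lambda>\<omega>. h * (\<Sum>k<n. B (real (Suc k) * h) \<omega>)
      - h / real (Suc m) * (\<Sum>j<n * Suc m. B (real j * (h / real (Suc m))) \<omega>)) (h * sqrt T)"
    by (simp only: \<delta>_def)
next
  fix \<omega> assume "\<omega> \<in> space M"
  then have "continuous_on {0..real n * h} (\<lambda>s. B s \<omega>)"
    using h by (intro continuous_on_subset[OF continuous_B]) auto
  then show "(\<lambda>m. h * (\<Sum>k<n. B (real (Suc k) * h) \<omega>)
      - h / real (Suc m) * (\<Sum>j<n * Suc m. B (real j * (h / real (Suc m))) \<omega>))
    \<longlonglongrightarrow> h * (\<Sum>k<n. B (real (Suc k) * h) \<omega>) - integral {0..real n * h} (\<lambda>s. B s \<omega>)"
    using h by (intro tendsto_diff tendsto_const riemann_sum_tendsto_integral)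
qed

text \<open>The triangle inequality suffices here: this term enters the error with a factor
  \<open>h\<close>, so a bound of order one is enough, and each increment from time 0 has L2 norm at
  most \<open>sqrt T\<close>.\<close>

lemma l2_integral_abs:
  assumes T: "0 < T"
  shows "l2_le M (\<lambda>\<omega>. integral {0..T} (\<lambda>s. \<bar>B s \<omega> - B 0 \<omega>\<bar>)) (T * sqrt T)"
proof (rule l2_le_LIMSEQ)
  fix m :: nat
  define \<delta> where "\<delta> = T / real (Suc m)"
  have \<delta>: "0 < \<delta>" "\<delta> * real (Suc m) = T" using T by (auto simp: \<delta>_def)
  have "l2_le M (\<lambda>\<omega>. \<bar>B (real j * \<delta>) \<omega> - B 0 \<omega>\<bar>) (sqrt T)" if "j < Suc m" for j
  \<comment> \<open>\<open>variance_B\<close> speaks of intervals of positive length; at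
    \<open>j = 0\<close> the increment is identically 0.\<close>
  proof (cases "j = 0")
    case True
    then show ?thesis using T by (simp add: l2_le_def)
  next
    case False
    have "real j * \<delta> \<le> real (Suc m) * \<delta>" using that \<delta> by (intro mult_right_mono) auto
    then have le: "real j * \<delta> \<le> T" using \<delta>(2) by (simp only: mult.commute)
    have p: "0 < real j * \<delta>" using False \<delta> by simp
    show ?thesis
      using variance_B[OF order_refl p le] measurable_B[of "real j * \<delta>"] measurable_B[of 0] le p T
      by (simp add: l2_le_def)
  qed
  then have "l2_le M (\<lambda>\<omega>. \<Sum>j<Suc m. \<bar>B (real j * \<delta>) \<omega> - B 0 \<omega>\<bar>) (\<Sum>j<Suc m. sqrt T)"
    using T by (intro l2_le_sum) auto
  then have "l2_le M (\<lambda>\<omega>. \<delta> * (\<Sum>j<Suc m. \<bar>B (real j * \<delta>) \<omega> - B 0 \<omega>\<bar>)) (\<delta> * (\<Sum>j<Suc m. sqrt T))"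
    by (rule l2_le_cmult)
  also have "\<delta> * (\<Sum>j<Suc m. sqrt T) = T * sqrt T"
    using \<delta>(2) by (simp only: sum_constant card_lessThan mult.assoc[symmetric])
  finally show "l2_le M (\<lambda>\<omega>. T / real (Suc m) * (\<Sum>j<1 * Suc m. \<bar>B (real j * (T / real (Suc m))) \<omega> - B 0 \<omega>\<bar>))
      (T * sqrt T)"
    by (simp only: \<delta>_def mult_1)
next
  fix \<omega> assume "\<omega> \<in> space M"
  then have "continuous_on {0..T} (\<lambda>s. \<bar>B s \<omega> - B 0 \<omega>\<bar>)"
    by (intro continuous_intros continuous_B)
  then show "(\<lambda>m. T / real (Suc m) * (\<Sum>j<1 * Suc m. \<bar>B (real j * (T / real (Suc m))) \<omega> - B 0 \<omega>\<bar>))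
    \<longlonglongrightarrow> integral {0..T} (\<lambda>s. \<bar>B s \<omega> - B 0 \<omega>\<bar>)"
    using riemann_sum_tendsto_integral[OF T, of 1 "\<lambda>s. \<bar>B s \<omega> - B 0 \<omega>\<bar>"] by simp
qed

end

subsection \<open>Measurability and the Brownian estimates\<close>

lemma borel_measurable_filtration:
  fixes f :: "'a \<Rightarrow> 'b::topological_space"
  assumes filt: "normal_filtration M T F" and "t \<in> {0..T}" "f \<in> borel_measurable (F t)"
  shows "f \<in> borel_measurable M"
proof -
  have "space (F t) = space M" "sets (F t) \<subseteq> sets M"
    using filt[unfolded normal_filtration_def, THEN conjunct1] assms(2) by auto
  with assms(3) show ?thesis by (auto simp: measurable_def)
qed

text \<open>The variance is the second moment of the normal law. For orthogonality, the earlier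
  increment is measurable with respect to \<open>F u\<close> by adaptedness and monotonicity of the
  filtration, while the later one is independent of \<open>F u\<close> and centred.\<close>

lemma brownian_component_orthogonal_increments:
  fixes W :: "real \<Rightarrow> 'a \<Rightarrow> real ^ 'd"
  assumes "prob_space M" and filt: "normal_filtration M T F" and bm: "brownian_motion M T F W"
  shows "orthogonal_increments M T (\<lambda>t \<omega>. W t \<omega> $ i)"
proof -
  interpret prob_space M by fact
  have WF: "W t \<in> borel_measurable (F t)" if "t \<in> {0..T}" for t
    using bm that unfolding brownian_motion_def by blast+
  have nth[measurable]: "(\<lambda>x::real^'d. x $ i) \<in> borel_measurable borel"
    by (intro borel_measurable_continuous_onI continuous_intros)
  have W: "W t \<in> borel_measurable M" if "t \<in> {0..T}" for t
    by (rule borel_measurable_filtration[OF filt that WF[OF that]])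
  have ind: "indep_set (sets (vimage_algebra (space M) (\<lambda>\<omega>. W t \<omega> - W s \<omega>) borel)) (sets (F s))"
    and dist: "distributed M lborel (\<lambda>\<omega>. (W t \<omega> - W s \<omega>) $ i) (normal_density 0 (sqrt (t - s)))"
    if "0 \<le> s" "s < t" "t \<le> T" for s t
    using bm that unfolding brownian_motion_def by blast+
  have int: "integrable M (\<lambda>\<omega>. (W t \<omega> - W s \<omega>) $ i)" "(\<integral>\<omega>. (W t \<omega> - W s \<omega>) $ i \<partial>M) = 0"
    if "0 \<le> s" "s < t" "t \<le> T" for s t
  proof -
    have "integrable lborel (\<lambda>x. normal_density 0 (sqrt (t - s)) x * x)"
      using integrable_normal_moment[of "sqrt (t - s)" 0 1] that
      by (simp only: power_one_right diff_zero real_sqrt_gt_0_iff diff_gt_0_iff_gt)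
    then show "integrable M (\<lambda>\<omega>. (W t \<omega> - W s \<omega>) $ i)"
      by (subst (asm) distributed_integrable[OF dist[OF that], of "\<lambda>x. x"]) auto
    show "(\<integral>\<omega>. (W t \<omega> - W s \<omega>) $ i \<partial>M) = 0"
      using that by (intro normal_distributed_expectation[OF _ dist[OF that]]) auto
  qed
  show ?thesis
  proof
    show "(\<lambda>\<omega>. W t \<omega> $ i) \<in> borel_measurable M" if "t \<in> {0..T}" for t
      by (rule measurable_compose[OF W[OF that] nth])
    show "continuous_on {0..T} (\<lambda>t. W t \<omega> $ i)" if "\<omega> \<in> space M" for \<omega>
    proof -
      have "continuous_on {0..T} (\<lambda>t. W t \<omega>)"
        using bm that unfolding brownian_motion_def by blast
      then show ?thesis by (intro continuous_intros)
    qed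
    show "integrable M (\<lambda>\<omega>. (W t \<omega> $ i - W s \<omega> $ i)\<^sup>2) \<and> (\<integral>\<omega>. (W t \<omega> $ i - W s \<omega> $ i)\<^sup>2 \<partial>M) = t - s"
      if st: "0 \<le> s" "s < t" "t \<le> T" for s t
    proof
      show "integrable M (\<lambda>\<omega>. (W t \<omega> $ i - W s \<omega> $ i)\<^sup>2)"
      proof -
        have "integrable lborel (\<lambda>x. normal_density 0 (sqrt (t - s)) x * x\<^sup>2)"
          using integrable_normal_moment[of "sqrt (t - s)" 0 2] st
          by (simp only: diff_zero real_sqrt_gt_0_iff diff_gt_0_iff_gt)
        then show ?thesis
          by (subst (asm) distributed_integrable[OF dist[OF st], of "\<lambda>x. x\<^sup>2"])
            (auto simp: vector_minus_component)
      qed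
      show "(\<integral>\<omega>. (W t \<omega> $ i - W s \<omega> $ i)\<^sup>2 \<partial>M) = t - s"
        using normal_distributed_variance[OF _ dist[OF st]] int(2)[OF st] st
        by (simp add: vector_minus_component)
    qed
    show "(\<integral>\<omega>. (W t \<omega> $ i - W s \<omega> $ i) * (W v \<omega> $ i - W u \<omega> $ i) \<partial>M) = 0"
      if "0 \<le> s" "s < t" "t \<le> u" "u < v" "v \<le> T" for s t u v
    proof -
      have uv: "0 \<le> u" "u < v" "v \<le> T" and st: "0 \<le> s" "s < t" "t \<le> T" using that by auto
      let ?X = "\<lambda>\<omega>. (W v \<omega> - W u \<omega>) $ i" and ?Y = "\<lambda>\<omega>. (W t \<omega> - W s \<omega>) $ i"
      have spF: "space (F r) = space M" if "r \<in> {0..T}" for r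
        using filt[unfolded normal_filtration_def, THEN conjunct1] that by blast
      have FF: "sets (F r) \<subseteq> sets (F u)" if "r \<in> {0..u}" for r
      proof -
        have "r \<in> {0..T}" "u \<in> {r..T}" using that uv by auto
        then show ?thesis
          using filt[unfolded normal_filtration_def, THEN conjunct2, THEN conjunct1] by blast
      qed
      have WFu: "W r \<in> borel_measurable (F u)" if "r \<in> {0..u}" for r
      proof -
        have "space (F r) = space (F u)" using spF[of r] spF[of u] that uv by simp
        then show ?thesis using WF[of r] FF[of r] that uv by (auto simp: measurable_def)
      qed
      have YF: "?Y \<in> borel_measurable (F u)"
        using that by (intro measurable_compose[OF borel_measurable_diff nth] WFu) auto
      \<comment> \<open>Independence is given between the sigma-algebra of the whole vector
        increment and \<open>F u\<close>; it passes to the smaller sigma-algebras generated by the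
        two scalar increments.\<close>
      have "indep_var borel ?X borel ?Y"
        unfolding indep_var_eq
      proof (intro conjI)
        show X: "random_variable borel ?X" using uv by (intro measurable_compose[OF borel_measurable_diff nth] W) auto
        show "random_variable borel ?Y" using st by (intro measurable_compose[OF borel_measurable_diff nth] W) auto
        have "sigma_sets (space M) {?X -` A \<inter> space M |A. A \<in> sets borel}
          \<subseteq> sets (vimage_algebra (space M) (\<lambda>\<omega>. W v \<omega> - W u \<omega>) borel)"
        proof -
          let ?V = "vimage_algebra (space M) (\<lambda>\<omega>. W v \<omega> - W u \<omega>) borel"
          have "?X \<in> borel_measurable ?V"
            by (rule measurable_compose[OF measurable_vimage_algebra1]) auto
          then have "{?X -` A \<inter> space M |A. A \<in> sets borel} \<subseteq> sets ?V"
            by (auto simp: measurable_def)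
          then have "sigma_sets (space ?V) {?X -` A \<inter> space M |A. A \<in> sets borel} \<subseteq> sets ?V"
            by (rule sets.sigma_sets_subset)
          then show ?thesis by simp
        qed
        moreover have "sigma_sets (space M) {?Y -` A \<inter> space M |A. A \<in> sets borel} \<subseteq> sets (F u)"
        proof -
          have "{?Y -` A \<inter> space M |A. A \<in> sets borel} \<subseteq> sets (F u)"
            using YF spF[of u] uv by (auto simp: measurable_def)
          then have "sigma_sets (space (F u)) {?Y -` A \<inter> space M |A. A \<in> sets borel} \<subseteq> sets (F u)"
            by (rule sets.sigma_sets_subset)
          then show ?thesis using spF[of u] uv by simp
        qed
        ultimately show "indep_set (sigma_sets (space M) {?X -` A \<inter> space M |A. A \<in> sets borel})
          (sigma_sets (space M) {?Y -` A \<inter> space M |A. A \<in> sets borel})"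
          using ind[OF uv] unfolding indep_sets2_eq by blast
      qed
      then have "(\<integral>\<omega>. ?X \<omega> * ?Y \<omega> \<partial>M) = (\<integral>\<omega>. ?X \<omega> \<partial>M) * (\<integral>\<omega>. ?Y \<omega> \<partial>M)"
        using int(1)[OF uv] int(1)[OF st] by (intro indep_var_lebesgue_integral)
      then show ?thesis using int(2)[OF uv] by (simp add: mult.commute)
    qed
  qed
qed

text \<open>The stage is known only as some pathwise solution of an implicit equation. Its
  right-hand side contracts with factor \<open>L * h\<^sup>2 / 2\<close>, at most 1/2, so that
  solution can be reached by measurable approximations.\<close>

lemma borel_measurable_implicit:
  fixes f :: "'v::euclidean_space \<Rightarrow> 'v"
  assumes lip: "L-lipschitz_on UNIV f" and h: "0 < h" "h \<le> 1" "L * h \<le> 1"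
    and x: "x \<in> borel_measurable M" and y: "y \<in> borel_measurable M"
    and \<psi>: "\<And>\<omega>. \<omega> \<in> space M \<Longrightarrow>
      \<psi> \<omega> = x \<omega> - (h / 2) *\<^sub>R integral {0..1} (\<lambda>s. f (y \<omega> + (s * h) *\<^sub>R \<psi> \<omega>))"
  shows "\<psi> \<in> borel_measurable M"
    and "(\<lambda>\<omega>. integral {0..1} (\<lambda>s. f (y \<omega> + (s * h) *\<^sub>R \<psi> \<omega>))) \<in> borel_measurable M"
proof -
  have L: "L \<ge> 0" using lip by (rule lipschitz_on_nonneg)
  have cf: "continuous_on A f" for A
    using lipschitz_on_continuous_on[OF lip] by (rule continuous_on_subset) auto
  define J where "J y z = integral {0..1} (\<lambda>s. f (y + (s * h) *\<^sub>R z))" for y z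
  have c: "continuous_on {0..1} (\<lambda>s. f (y + (s * h) *\<^sub>R z))" for y z
    by (rule continuous_on_compose2[OF cf[of UNIV]]) (auto intro!: continuous_intros)
  have J: "norm (J y z - J y' z') \<le> L * (norm (y - y') + h * norm (z - z'))" for y z y' z'
  proof -
    have "J y z - J y' z' = integral {0..1} (\<lambda>s. f (y + (s * h) *\<^sub>R z) - f (y' + (s * h) *\<^sub>R z'))"
      unfolding J_def
      by (intro Henstock_Kurzweil_Integration.integral_diff[symmetric] integrable_continuous_real c)
    also have "norm \<dots> \<le> (1 - 0) * (L * (norm (y - y') + h * norm (z - z')))"
    proof (rule norm_integral_le_const)
      fix s :: real assume s: "s \<in> {0..1}"
      have "norm (f (y + (s * h) *\<^sub>R z) - f (y' + (s * h) *\<^sub>R z'))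
        \<le> L * norm ((y - y') + (s * h) *\<^sub>R (z - z'))"
        using lipschitz_on_normD_UNIV[OF lip, of "y + (s * h) *\<^sub>R z" "y' + (s * h) *\<^sub>R z'"]
        by (simp add: algebra_simps)
      also have "\<dots> \<le> L * (norm (y - y') + h * norm (z - z'))"
      proof (intro mult_left_mono L norm_triangle_le add_left_mono)
        have "s * h \<le> h" using s h by (simp add: mult_left_le_one_le)
        then show "norm ((s * h) *\<^sub>R (z - z')) \<le> h * norm (z - z')"
          using s h by (simp add: mult_right_mono abs_mult)
      qed
      finally show "norm (f (y + (s * h) *\<^sub>R z) - f (y' + (s * h) *\<^sub>R z'))
        \<le> L * (norm (y - y') + h * norm (z - z'))" .
    qed (auto intro!: continuous_intros c)
    finally show ?thesis by simp
  qed
  have cJ: "continuous_on UNIV (\<lambda>p. J (fst p) (snd p))"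
    unfolding continuous_on_iff
  proof (intro ballI allI impI)
    fix p :: "'v \<times> 'v" and e :: real assume e: "0 < e"
    show "\<exists>d>0. \<forall>p'\<in>UNIV. dist p' p < d \<longrightarrow> dist (J (fst p') (snd p')) (J (fst p) (snd p)) < e"
    proof (intro exI conjI ballI impI)
      \<comment> \<open>\<open>J\<close> is Lipschitz with constant \<open>L * (1 + h)\<close>; the
        summand 1 keeps the divisor positive when \<open>L = 0\<close>.\<close>
      show "0 < e / (L * (1 + h) + 1)" using e L h by (intro divide_pos_pos) (auto intro: add_nonneg_pos)
      fix p' assume d: "dist p' p < e / (L * (1 + h) + 1)"
      have pos: "0 < L * (1 + h) + 1" using L h by (auto intro: add_nonneg_pos)
      have "dist (J (fst p') (snd p')) (J (fst p) (snd p))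
        \<le> L * (norm (fst p' - fst p) + h * norm (snd p' - snd p))"
        using J by (simp add: dist_norm)
      also have "\<dots> \<le> L * (dist p' p + h * dist p' p)"
        using L h dist_fst_le[of p' p] dist_snd_le[of p' p]
        by (intro mult_left_mono add_mono) (auto simp: dist_norm)
      also have "\<dots> \<le> (L * (1 + h) + 1) * dist p' p" by (simp add: algebra_simps)
      also have "\<dots> < e" using d pos by (simp add: pos_less_divide_eq mult.commute)
      finally show "dist (J (fst p') (snd p')) (J (fst p) (snd p)) < e" .
    qed
  qed
  \<comment> \<open>The solution of the implicit equation is the limit of the fixed-point iteration \<open>u\<close>.\<close>
  define u where "u = rec_nat (\<lambda>_. 0) (\<lambda>_ v \<omega>. x \<omega> - (h / 2) *\<^sub>R J (y \<omega>) (v \<omega>))"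
  have u0: "u 0 = (\<lambda>_. 0)" and uS: "u (Suc k) = (\<lambda>\<omega>. x \<omega> - (h / 2) *\<^sub>R J (y \<omega>) (u k \<omega>))" for k
    by (simp_all add: u_def)
  have um: "u k \<in> borel_measurable M" for k
    by (induction k) (auto simp: u0 uS intro!: borel_measurable_diff borel_measurable_scaleR x
        borel_measurable_continuous_Pair[OF y _ cJ])
  have bound: "norm (u k \<omega> - \<psi> \<omega>) \<le> (1 / 2) ^ k * norm (\<psi> \<omega>)" if \<omega>: "\<omega> \<in> space M" for k \<omega>
  proof (induction k)
    case (Suc k)
    have "\<psi> \<omega> + (h / 2) *\<^sub>R J (y \<omega>) (\<psi> \<omega>) = x \<omega>"
      unfolding J_def eq_diff_eq[symmetric] by (rule \<psi>[OF \<omega>])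
    from this[symmetric]
    have "u (Suc k) \<omega> - \<psi> \<omega> = (h / 2) *\<^sub>R (J (y \<omega>) (\<psi> \<omega>) - J (y \<omega>) (u k \<omega>))"
      by (simp add: uS scaleR_diff_right)
    then have "norm (u (Suc k) \<omega> - \<psi> \<omega>) = h / 2 * norm (J (y \<omega>) (\<psi> \<omega>) - J (y \<omega>) (u k \<omega>))"
      using h by simp
    also have "\<dots> \<le> h / 2 * (L * (h * norm (u k \<omega> - \<psi> \<omega>)))"
      using h J[of "y \<omega>" "\<psi> \<omega>" "y \<omega>" "u k \<omega>"]
      by (intro mult_left_mono) (auto simp: norm_minus_commute)
    also have "\<dots> = (L * h) * h / 2 * norm (u k \<omega> - \<psi> \<omega>)" by simp
    also have "\<dots> \<le> 1 / 2 * norm (u k \<omega> - \<psi> \<omega>)"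
      using h L mult_mono[of "L * h" 1 h 1] by (intro mult_right_mono) auto
    also have "\<dots> \<le> 1 / 2 * ((1 / 2) ^ k * norm (\<psi> \<omega>))" using Suc by (intro mult_left_mono) auto
    finally show ?case by simp
  qed (simp add: u0)
  have lim: "(\<lambda>k. u k \<omega>) \<longlonglongrightarrow> \<psi> \<omega>" if "\<omega> \<in> space M" for \<omega>
  proof -
    have "(\<lambda>k. (1 / 2) ^ k * norm (\<psi> \<omega>)) \<longlonglongrightarrow> 0 * norm (\<psi> \<omega>)"
      by (intro tendsto_mult tendsto_const LIMSEQ_realpow_zero) auto
    then have "(\<lambda>k. (1 / 2) ^ k * norm (\<psi> \<omega>)) \<longlonglongrightarrow> 0"
      by (simp only: mult_zero_left)
    with eventuallyI[of "\<lambda>k. norm (u k \<omega> - \<psi> \<omega>) \<le> (1 / 2) ^ k * norm (\<psi> \<omega>)", OF bound[OF that]]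
    have "(\<lambda>k. u k \<omega> - \<psi> \<omega>) \<longlonglongrightarrow> 0"
      by (rule Lim_null_comparison)
    then show ?thesis by (rule LIM_zero_cancel)
  qed
  show m: "\<psi> \<in> borel_measurable M" by (rule borel_measurable_LIMSEQ_metric[OF um lim])
  show "(\<lambda>\<omega>. integral {0..1} (\<lambda>s. f (y \<omega> + (s * h) *\<^sub>R \<psi> \<omega>))) \<in> borel_measurable M"
    using borel_measurable_continuous_Pair[OF y m cJ] by (simp add: J_def)
qed

lemma drift_preserving_scheme_measurable:
  fixes W :: "real \<Rightarrow> 'a \<Rightarrow> real ^ 'd" and V' :: "real ^ 'm \<Rightarrow> real ^ 'm"
  assumes lip: "L-lipschitz_on UNIV V'" and h: "0 < h" "h \<le> 1" "L * h \<le> 1"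
    and W: "\<And>n. n \<le> N \<Longrightarrow> W (real n * h) \<in> borel_measurable M"
    and p0: "p0 \<in> borel_measurable M" and q0: "q0 \<in> borel_measurable M"
    and scheme: "drift_preserving_scheme M W V' S p0 q0 h N \<Psi> P Q"
    and n: "n \<le> N"
  shows "P n \<in> borel_measurable M \<and> Q n \<in> borel_measurable M"
  using n
proof (induction n)
  case 0
  \<comment> \<open>The scheme prescribes values on \<open>space M\<close> only, so measurability is
    transferred by congruence here and in the induction step.\<close>
  have "P 0 \<omega> = p0 \<omega>" "Q 0 \<omega> = q0 \<omega>" if "\<omega> \<in> space M" for \<omega>
    using bspec[OF scheme[unfolded drift_preserving_scheme_def] that] by blast+
  then have "P 0 \<in> borel_measurable M \<longleftrightarrow> p0 \<in> borel_measurable M"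
    "Q 0 \<in> borel_measurable M \<longleftrightarrow> q0 \<in> borel_measurable M"
    by (auto intro!: measurable_cong)
  then show ?case using p0 q0 by simp
next
  case (Suc n)
  then have [measurable]: "P n \<in> borel_measurable M" "Q n \<in> borel_measurable M"
    and n: "n < N" by auto
  define x where "x \<omega> = P n \<omega> + S *v (W (real (Suc n) * h) \<omega> - W (real n * h) \<omega>)" for \<omega>
  define I where "I \<omega> = integral {0..1} (\<lambda>s. V' (Q n \<omega> + (s * h) *\<^sub>R \<Psi> (Suc n) \<omega>))" for \<omega>
  have st: "\<Psi> (Suc n) \<omega> = x \<omega> - (h / 2) *\<^sub>R I \<omega>" "Q (Suc n) \<omega> = Q n \<omega> + h *\<^sub>R \<Psi> (Suc n) \<omega>"
    "P (Suc n) \<omega> = x \<omega> - h *\<^sub>R I \<omega>" if "\<omega> \<in> space M" for \<omega>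
    using bspec[OF scheme[unfolded drift_preserving_scheme_def Let_def] that,
        THEN conjunct2, THEN conjunct2, rule_format, OF n]
    unfolding x_def I_def by blast+
  have "(*v) S \<in> borel_measurable borel"
    by (intro borel_measurable_continuous_onI linear_continuous_on matrix_vector_mul_bounded_linear)
  then have x[measurable]: "x \<in> borel_measurable M"
    unfolding x_def using W[of n] W[of "Suc n"] n
    by (intro borel_measurable_add measurable_compose[of _ M borel "(*v) S" borel] borel_measurable_diff) auto
  have [measurable]: "\<Psi> (Suc n) \<in> borel_measurable M"
    by (rule borel_measurable_implicit(1)[OF lip h x \<open>Q n \<in> borel_measurable M\<close>])
      (rule st(1)[unfolded I_def])
  have [measurable]: "I \<in> borel_measurable M"
    unfolding I_def
    by (rule borel_measurable_implicit(2)[OF lip h x \<open>Q n \<in> borel_measurable M\<close>])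
      (rule st(1)[unfolded I_def])
  have "Q (Suc n) \<in> borel_measurable M \<longleftrightarrow> (\<lambda>\<omega>. Q n \<omega> + h *\<^sub>R \<Psi> (Suc n) \<omega>) \<in> borel_measurable M"
    by (rule measurable_cong) (rule st(2))
  moreover have "P (Suc n) \<in> borel_measurable M \<longleftrightarrow> (\<lambda>\<omega>. x \<omega> - h *\<^sub>R I \<omega>) \<in> borel_measurable M"
    by (rule measurable_cong) (rule st(3))
  ultimately show ?case by simp
qed

text \<open>The quadrature error is linear in the path and vanishes on constants, so the matrix
  comes out as an operator norm and the shift by \<open>w 0\<close> drops out. What remains are
  scalar quadrature errors of the components of \<open>w\<close>.\<close>

lemma noise_quadrature_bound:
  fixes S :: "real ^ 'd ^ 'm" and w :: "real \<Rightarrow> real ^ 'd"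
  assumes h: "0 \<le> h" and w: "continuous_on {0..real n * h} w"
  defines "X \<equiv> \<lambda>t. S *v (w t - w 0)"
  shows "norm (h *\<^sub>R (\<Sum>k<n. X (real (Suc k) * h)) - integral {0..real n * h} X)
    \<le> onorm ((*v) S) *
      (\<Sum>i\<in>UNIV. \<bar>h * (\<Sum>k<n. w (real (Suc k) * h) $ i) - integral {0..real n * h} (\<lambda>s. w s $ i)\<bar>)"
proof -
  have nh: "0 \<le> real n * h" using h by simp
  have iw: "w integrable_on {0..real n * h}" using w by (rule integrable_continuous_real)
  have lin: "linear ((*v) S)" by (rule matrix_vector_mul_linear)
  define Y where "Y = h *\<^sub>R (\<Sum>k<n. w (real (Suc k) * h)) - integral {0..real n * h} w"
  have "integral {0..real n * h} X = S *v (integral {0..real n * h} (\<lambda>s. w s - w 0))"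
    unfolding X_def using iw
    by (intro integral_linear[unfolded o_def] matrix_vector_mul_bounded_linear integrable_diff) auto
  also have "integral {0..real n * h} (\<lambda>s. w s - w 0)
      = integral {0..real n * h} w - (real n * h) *\<^sub>R w 0"
    using iw nh by (subst Henstock_Kurzweil_Integration.integral_diff) auto
  finally have 1: "integral {0..real n * h} X = S *v (integral {0..real n * h} w - (real n * h) *\<^sub>R w 0)" .
  have 2: "h *\<^sub>R (\<Sum>k<n. X (real (Suc k) * h)) = S *v (h *\<^sub>R ((\<Sum>k<n. w (real (Suc k) * h)) - real n *\<^sub>R w 0))"
    unfolding X_def
    by (simp only: linear_sum[OF lin, symmetric] linear_scale[OF lin, symmetric] sum_subtractf
        sum_constant_scaleR card_lessThan)
  have "Y = h *\<^sub>R ((\<Sum>k<n. w (real (Suc k) * h)) - real n *\<^sub>R w 0)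
      - (integral {0..real n * h} w - (real n * h) *\<^sub>R w 0)"
    by (simp add: Y_def algebra_simps)
  then have "h *\<^sub>R (\<Sum>k<n. X (real (Suc k) * h)) - integral {0..real n * h} X = S *v Y"
    by (simp only: 1 2 linear_diff[OF lin])
  then have "norm (h *\<^sub>R (\<Sum>k<n. X (real (Suc k) * h)) - integral {0..real n * h} X)
    \<le> onorm ((*v) S) * norm Y"
    using onorm[OF matrix_vector_mul_bounded_linear, of S Y] by simp
  also have "\<dots> \<le> onorm ((*v) S) * (\<Sum>i\<in>UNIV. \<bar>Y $ i\<bar>)"
    by (intro mult_left_mono norm_le_l1_cart onorm_pos_le matrix_vector_mul_bounded_linear)
  also have "(\<lambda>i. Y $ i) = (\<lambda>i. h * (\<Sum>k<n. w (real (Suc k) * h) $ i) - integral {0..real n * h} (\<lambda>s. w s $ i))"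
    using integral_linear[OF iw bounded_linear_vec_nth] by (simp add: Y_def o_def)
  finally show ?thesis .
qed

lemma noise_integral_bound:
  fixes S :: "real ^ 'd ^ 'm" and w :: "real \<Rightarrow> real ^ 'd"
  assumes w: "continuous_on {0..T} w"
  shows "integral {0..T} (\<lambda>t. norm (S *v (w t - w 0)))
    \<le> onorm ((*v) S) * (\<Sum>i\<in>UNIV. integral {0..T} (\<lambda>t. \<bar>w t $ i - w 0 $ i\<bar>))"
proof -
  have "integral {0..T} (\<lambda>t. norm (S *v (w t - w 0)))
    \<le> integral {0..T} (\<lambda>t. onorm ((*v) S) * (\<Sum>i\<in>UNIV. \<bar>w t $ i - w 0 $ i\<bar>))"
  proof (rule integral_le)
    fix t
    have "norm (S *v (w t - w 0)) \<le> onorm ((*v) S) * norm (w t - w 0)"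
      by (rule onorm[OF matrix_vector_mul_bounded_linear])
    also have "\<dots> \<le> onorm ((*v) S) * (\<Sum>i\<in>UNIV. \<bar>w t $ i - w 0 $ i\<bar>)"
      using norm_le_l1_cart[of "w t - w 0"]
      by (intro mult_left_mono onorm_pos_le matrix_vector_mul_bounded_linear) simp
    finally show "norm (S *v (w t - w 0)) \<le> onorm ((*v) S) * (\<Sum>i\<in>UNIV. \<bar>w t $ i - w 0 $ i\<bar>)" .
  qed (intro integrable_continuous_real continuous_intros w
      bounded_linear.continuous_on[OF matrix_vector_mul_bounded_linear])+
  also have "\<dots> = onorm ((*v) S) * (\<Sum>i\<in>UNIV. integral {0..T} (\<lambda>t. \<bar>w t $ i - w 0 $ i\<bar>))"
    by (auto intro!: Henstock_Kurzweil_Integration.integral_sum integrable_continuous_real continuous_intros w)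
  finally show ?thesis .
qed

subsection \<open>Mean-square convergence\<close>

text \<open>One majorant \<open>G\<close> serves both errors and is a combination, with positive
  coefficients, of quantities whose L2 norms are known. In \<open>\<Phi>\<close>,
  \<open>2 * c * A + 3 * B\<close> is bounded by \<open>(2 * c + 3 * L) * E + 3 * \<kappa>\<close>,
  and the further \<open>3 * E\<close> ensures \<open>A \<le> \<Phi>\<close>. In \<open>G\<close>,
  the position error needs \<open>h * \<Phi>\<close> and \<open>4 * c\<close> times the bound of
  \<open>Z\<close>, the momentum error \<open>L * h * \<Phi>\<close> and \<open>2 * L\<close> times
  that bound; the coefficients add these up. \<open>K\<close> and \<open>\<kappa>\<close> are upper
  bounds, so they can be chosen positive.\<close>

lemma pathwise_error_bound:
  fixes f :: "real ^ 'm \<Rightarrow> real ^ 'm" and p q :: "real \<Rightarrow> real ^ 'm" and w :: "real \<Rightarrow> real ^ 'd"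
    and S :: "real ^ 'd ^ 'm" and P Q \<Psi> :: "nat \<Rightarrow> real ^ 'm"
  assumes lip: "L-lipschitz_on UNIV f"
    and h: "0 < h" "h \<le> 1" "4 * (L * (T + 1)) * h \<le> 1" and Nh: "real N * h = T"
    and cp: "continuous_on {0..T} p" and cq: "continuous_on {0..T} q"
    and cw: "continuous_on {0..T} w"
    and q: "\<And>t. t \<in> {0..T} \<Longrightarrow> q t = q0 + integral {0..t} p"
    and p: "\<And>t. t \<in> {0..T} \<Longrightarrow> p t = p0 - integral {0..t} (\<lambda>s. f (q s)) + S *v (w t - w 0)"
    and P0: "P 0 = p0" and Q0: "Q 0 = q0"
    and I: "\<And>k. k < N \<Longrightarrow> I k = integral {0..1} (\<lambda>s. f (Q k + (s * h) *\<^sub>R \<Psi> (Suc k)))"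
    and Psi: "\<And>k. k < N \<Longrightarrow>
      \<Psi> (Suc k) = P k + S *v (w (real (Suc k) * h) - w (real k * h)) - (h / 2) *\<^sub>R I k"
    and QS: "\<And>k. k < N \<Longrightarrow> Q (Suc k) = Q k + h *\<^sub>R \<Psi> (Suc k)"
    and PS: "\<And>k. k < N \<Longrightarrow>
      P (Suc k) = P k + S *v (w (real (Suc k) * h) - w (real k * h)) - h *\<^sub>R I k"
    and n: "n \<le> N"
    and \<kappa>: "T * norm (f 0) \<le> \<kappa>" and K: "onorm ((*v) S) \<le> K"
  defines "c \<equiv> L * (T + 1)"
    and "\<rho> \<equiv> \<lambda>n. \<Sum>i\<in>UNIV. \<bar>h * (\<Sum>k<n. w (real (Suc k) * h) $ i)
      - integral {0..real n * h} (\<lambda>s. w s $ i)\<bar>"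
    and "E \<equiv> exp ((L + 1) * T) * (T * (norm p0 + norm q0 + \<kappa>)
      + K * (\<Sum>i\<in>UNIV. integral {0..T} (\<lambda>t. \<bar>w t $ i - w 0 $ i\<bar>)))"
  defines "\<Phi> \<equiv> (2 * c + 3 * L + 3) * E + 3 * \<kappa>"
  defines "G \<equiv> 2 * K * \<rho> n + (L + 1) * h * \<Phi>
      + (4 * c + 2 * L + 1) * exp (4 * c * (T + 1)) * (h * (2 * K * (\<Sum>k\<le>N. \<rho> k) + (T + 1) * \<Phi>))"
  shows "norm (q (real n * h) - Q n) \<le> G" and "norm (p (real n * h) - P n) \<le> G"
proof -
  have L: "L \<ge> 0" using lip by (rule lipschitz_on_nonneg)
  have T: "T \<ge> 0" using Nh h by auto
  have c: "c \<ge> 0" using L T by (simp add: c_def)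
  have K0: "K \<ge> 0"
    using onorm_pos_le[OF matrix_vector_mul_bounded_linear, of S] K by simp
  have \<kappa>0: "\<kappa> \<ge> 0" using \<kappa> T by (meson mult_nonneg_nonneg norm_ge_zero order_trans)
  define X where "X = (\<lambda>t. S *v (w t - w 0))"
  have X_eq: "S *v (w t - w 0) = X t" for t by (simp add: X_def)
  have cX: "continuous_on {0..T} X"
    unfolding X_def
    by (intro bounded_linear.continuous_on[OF matrix_vector_mul_bounded_linear] continuous_intros cw)
  have X0: "X 0 = 0" by (simp add: X_def)
  have dX: "S *v (w t - w s) = X t - X s" for s t
    by (simp add: X_def matrix_vector_mult_diff_distrib[symmetric])
  define A where "A = integral {0..T} (\<lambda>s. norm (p s))"
  define B where "B = integral {0..T} (\<lambda>s. norm (f (q s)))"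
  define R where "R n = h *\<^sub>R (\<Sum>k<n. X (real (Suc k) * h)) - integral {0..real n * h} X" for n
  define Z where "Z = h * (exp (4 * c * (T + 1)) *
      (2 * (\<Sum>k\<le>N. norm (R k)) + (T + 1) * (2 * c * A + 3 * B)))"
  note err = scheme_error_bound[OF lip h Nh cp cq cX q p[unfolded X_eq] X0 P0 Q0 I
      Psi[unfolded dX] QS PS[unfolded dX] n, folded R_def A_def B_def c_def, folded Z_def]
  have \<rho>0: "\<rho> k \<ge> 0" for k unfolding \<rho>_def by (intro sum_nonneg) auto
  have R: "norm (R k) \<le> K * \<rho> k" if k: "k \<le> N" for k
  proof -
    have "real k * h \<le> T" using k h unfolding Nh[symmetric] by (intro mult_right_mono) auto
    then have "continuous_on {0..real k * h} w" by (intro continuous_on_subset[OF cw]) auto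
    from noise_quadrature_bound[OF _ this, of S]
    have "norm (R k) \<le> onorm ((*v) S) * \<rho> k" using h by (simp add: R_def \<rho>_def X_def)
    also have "\<dots> \<le> K * \<rho> k" using K \<rho>0 by (rule mult_right_mono)
    finally show ?thesis .
  qed
  define \<xi> where "\<xi> = (\<Sum>i\<in>UNIV. integral {0..T} (\<lambda>t. \<bar>w t $ i - w 0 $ i\<bar>))"
  have \<xi>0: "\<xi> \<ge> 0" unfolding \<xi>_def
    by (intro sum_nonneg Henstock_Kurzweil_Integration.integral_nonneg integrable_continuous_real
        continuous_intros cw) auto
  have "integral {0..T} (\<lambda>t. norm (X t)) \<le> onorm ((*v) S) * \<xi>"
    unfolding X_def \<xi>_def using cw by (rule noise_integral_bound)
  also have "\<dots> \<le> K * \<xi>" using K \<xi>0 by (rule mult_right_mono)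
  finally have "exp ((L + 1) * T) * (T * (norm p0 + norm q0 + T * norm (f 0))
      + integral {0..T} (\<lambda>t. norm (X t))) \<le> E"
    unfolding E_def \<xi>_def[symmetric] using \<kappa> T
    by (intro mult_left_mono add_mono order_refl) auto
  with solution_integral_bound[OF T lip cp cq cX q p[unfolded X_eq]] L
  have A: "A \<le> E" and B: "B \<le> \<kappa> + L * E"
    using \<kappa> mult_left_mono[of _ E L] unfolding A_def B_def by (meson order_trans add_mono)+
  have E0: "E \<ge> 0" unfolding E_def \<xi>_def[symmetric]
    using T K0 \<xi>0 \<kappa>0 by (intro mult_nonneg_nonneg add_nonneg_nonneg) auto
  have AB: "2 * c * A + 3 * B \<le> \<Phi>"
  proof -
    have "2 * c * A \<le> 2 * c * E" using A c by (intro mult_left_mono) auto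
    then show ?thesis using B E0 by (simp add: \<Phi>_def algebra_simps)
  qed
  have \<Phi>0: "\<Phi> \<ge> 0" using c L E0 \<kappa>0 by (auto simp: \<Phi>_def)
  have A\<Phi>: "A \<le> \<Phi>"
  proof -
    have "1 * E \<le> (2 * c + 3 * L + 3) * E" using c L E0 by (intro mult_right_mono) auto
    then show ?thesis using A \<kappa>0 by (simp add: \<Phi>_def)
  qed
  define g where "g = exp (4 * c * (T + 1))"
  define Y where "Y = g * (h * (2 * K * (\<Sum>k\<le>N. \<rho> k) + (T + 1) * \<Phi>))"
  have ZY: "Z \<le> Y"
  proof -
    have "(\<Sum>k\<le>N. norm (R k)) \<le> K * (\<Sum>k\<le>N. \<rho> k)"
      unfolding sum_distrib_left by (intro sum_mono R) auto
    then have "2 * (\<Sum>k\<le>N. norm (R k)) + (T + 1) * (2 * c * A + 3 * B)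
      \<le> 2 * K * (\<Sum>k\<le>N. \<rho> k) + (T + 1) * \<Phi>"
      using AB T by (intro add_mono mult_left_mono) auto
    then have "h * g * (2 * (\<Sum>k\<le>N. norm (R k)) + (T + 1) * (2 * c * A + 3 * B))
      \<le> h * g * (2 * K * (\<Sum>k\<le>N. \<rho> k) + (T + 1) * \<Phi>)"
      using h by (intro mult_left_mono) (auto simp: g_def)
    then show ?thesis by (simp add: Z_def Y_def g_def mult_ac)
  qed
  have Y0: "Y \<ge> 0" unfolding Y_def g_def
    using h K0 T \<rho>0 \<Phi>0 by (intro mult_nonneg_nonneg add_nonneg_nonneg sum_nonneg) auto
  have G: "G = 2 * K * \<rho> n + (L + 1) * h * \<Phi> + (4 * c + 2 * L + 1) * Y"
    by (simp add: G_def Y_def g_def mult.assoc)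
  have "h * (2 * c * A + 3 * B) \<le> h * \<Phi>" using AB h by (intro mult_left_mono) auto
  moreover have "4 * c * Z \<le> 4 * c * Y" using ZY c by (intro mult_left_mono) auto
  moreover have "0 \<le> L * (h * \<Phi>)" "0 \<le> L * Y" using L h \<Phi>0 Y0 by auto
  ultimately show "norm (q (real n * h) - Q n) \<le> G"
    using err(1) R[OF n] Y0 unfolding G by (simp add: algebra_simps)
  have "h * A \<le> h * \<Phi>" using A\<Phi> h by (intro mult_left_mono) auto
  then have "L * (h * A + 2 * Z) \<le> L * (h * \<Phi> + 2 * Y)"
    using ZY L by (intro mult_left_mono[OF add_mono]) auto
  moreover have "0 \<le> h * \<Phi>" "0 \<le> c * Y" "0 \<le> K * \<rho> n" using h \<Phi>0 c Y0 K0 \<rho>0[of n] by auto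
  ultimately show "norm (p (real n * h) - P n) \<le> G"
    using err(2) Y0 unfolding G by (simp add: algebra_simps)
qed

text \<open>\<open>C\<close> has the shape of the majorant \<open>G\<close> with each random term
  replaced by its L2 bound: \<open>\<phi>\<close> stands for \<open>\<Phi>\<close>, and a quadrature
  error contributes \<open>h * sqrt T\<close> for each of the \<open>d\<close> noise
  components.\<close>

lemma scheme_error_l2:
  fixes M :: "'a measure" and f :: "real ^ 'm \<Rightarrow> real ^ 'm" and S :: "real ^ 'd ^ 'm"
    and W :: "real \<Rightarrow> 'a \<Rightarrow> real ^ 'd"
  assumes M: "prob_space M" and T: "0 < T" and lip: "L-lipschitz_on UNIV f"
    and filt: "normal_filtration M T F" and bm: "brownian_motion M T F W"
    and p0: "l2_le M (\<lambda>\<omega>. norm (p0 \<omega>)) a" "p0 \<in> borel_measurable M"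
    and q0: "l2_le M (\<lambda>\<omega>. norm (q0 \<omega>)) a" "q0 \<in> borel_measurable M" and a: "0 < a"
    and sde: "sde_solution M T F W f S p0 q0 p q"
    and h: "0 < h" "h \<le> 1" "4 * (L * (T + 1)) * h \<le> 1" and Nh: "real N * h = T"
    and scheme: "drift_preserving_scheme M W f S p0 q0 h N \<Psi> P Q"
    and n: "n \<le> N"
    and \<kappa>: "0 < \<kappa>" "T * norm (f 0) \<le> \<kappa>" and K: "0 < K" "onorm ((*v) S) \<le> K"
  defines "c \<equiv> L * (T + 1)" and "d \<equiv> real CARD('d)"
  defines "\<phi> \<equiv> (2 * c + 3 * L + 3) *
      (exp ((L + 1) * T) * (T * (a + a + \<kappa>) + K * (d * (T * sqrt T)))) + 3 * \<kappa>"
  defines "C \<equiv> 2 * K * (d * sqrt T) + (L + 1) * \<phi>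
      + (4 * c + 2 * L + 1) * exp (4 * c * (T + 1)) * (2 * K * ((T + 1) * (d * sqrt T)) + (T + 1) * \<phi>)"
  shows "l2_le M (\<lambda>\<omega>. norm (q (real n * h) \<omega> - Q n \<omega>)) (C * h)"
    and "l2_le M (\<lambda>\<omega>. norm (p (real n * h) \<omega> - P n \<omega>)) (C * h)"
proof -
  interpret prob_space M by fact
  have L: "L \<ge> 0" using lip by (rule lipschitz_on_nonneg)
  have c: "c \<ge> 0" using L T by (simp add: c_def)
  have d: "0 < d" by (simp add: d_def)
  have tN: "real k * h \<in> {0..T}" if "k \<le> N" for k
    using that h unfolding Nh[symmetric] by (auto intro!: mult_right_mono)
  have oi: "orthogonal_increments M T (\<lambda>t \<omega>. W t \<omega> $ i)" for i
    by (rule brownian_component_orthogonal_increments[OF M filt bm])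
  define \<rho> where "\<rho> n \<omega> = (\<Sum>i\<in>UNIV. \<bar>h * (\<Sum>k<n. W (real (Suc k) * h) \<omega> $ i)
      - integral {0..real n * h} (\<lambda>s. W s \<omega> $ i)\<bar>)" for n \<omega>
  define E where "E \<omega> = exp ((L + 1) * T) * (T * (norm (p0 \<omega>) + norm (q0 \<omega>) + \<kappa>)
      + K * (\<Sum>i\<in>UNIV. integral {0..T} (\<lambda>t. \<bar>W t \<omega> $ i - W 0 \<omega> $ i\<bar>)))" for \<omega>
  define \<Phi> where "\<Phi> \<omega> = (2 * c + 3 * L + 3) * E \<omega> + 3 * \<kappa>" for \<omega>
  define G where "G \<omega> = 2 * K * \<rho> n \<omega> + (L + 1) * h * \<Phi> \<omega>
      + (4 * c + 2 * L + 1) * exp (4 * c * (T + 1)) * (h * (2 * K * (\<Sum>k\<le>N. \<rho> k \<omega>) + (T + 1) * \<Phi> \<omega>))" for \<omega>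
  have l2\<rho>: "l2_le M (\<rho> k) (d * (h * sqrt T))" if k: "k \<le> N" for k
  proof -
    have "l2_le M (\<rho> k) (\<Sum>i\<in>(UNIV::'d set). h * sqrt T)"
      unfolding \<rho>_def
    proof (intro l2_le_sum)
      fix i :: 'd
      have "l2_le M (\<lambda>\<omega>. h * (\<Sum>k<k. W (real (Suc k) * h) \<omega> $ i)
          - integral {0..real k * h} (\<lambda>s. W s \<omega> $ i)) (h * sqrt T)"
        using tN[OF k] h by (intro orthogonal_increments.l2_quadrature_error[OF oi]) auto
      then show "l2_le M (\<lambda>\<omega>. \<bar>h * (\<Sum>k<k. W (real (Suc k) * h) \<omega> $ i)
          - integral {0..real k * h} (\<lambda>s. W s \<omega> $ i)\<bar>) (h * sqrt T)"
        by (rule l2_le_abs)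
    qed (use h T in auto)
    then show ?thesis by (simp add: d_def)
  qed
  \<comment> \<open>There are \<open>N + 1\<close> terms of order \<open>h\<close>, so the sum is of
    order one; in \<open>G\<close> it is multiplied by \<open>h\<close> again.\<close>
  have l2\<rho>sum: "l2_le M (\<lambda>\<omega>. \<Sum>k\<le>N. \<rho> k \<omega>) ((T + 1) * (d * sqrt T))"
  proof (rule l2_le_mono)
    show "l2_le M (\<lambda>\<omega>. \<Sum>k\<le>N. \<rho> k \<omega>) (\<Sum>k\<le>N. d * (h * sqrt T))"
      using h d T by (intro l2_le_sum l2\<rho>) auto
    have "(\<Sum>k\<le>N. d * (h * sqrt T)) = (real N * h + h) * (d * sqrt T)"
      by (simp add: algebra_simps)
    then have eq: "(\<Sum>k\<le>N. d * (h * sqrt T)) = (T + h) * (d * sqrt T)"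
      by (simp only: Nh)
    show "0 \<le> (\<Sum>k\<le>N. d * (h * sqrt T))" "(\<Sum>k\<le>N. d * (h * sqrt T)) \<le> (T + 1) * (d * sqrt T)"
      unfolding eq using h d T by (auto intro!: mult_right_mono)
  qed
  have "l2_le M (\<lambda>\<omega>. \<Sum>i\<in>UNIV. integral {0..T} (\<lambda>t. \<bar>W t \<omega> $ i - W 0 \<omega> $ i\<bar>))
      (\<Sum>i\<in>(UNIV::'d set). T * sqrt T)"
    using T by (intro l2_le_sum orthogonal_increments.l2_integral_abs[OF oi]) auto
  then have l2\<xi>: "l2_le M (\<lambda>\<omega>. \<Sum>i\<in>UNIV. integral {0..T} (\<lambda>t. \<bar>W t \<omega> $ i - W 0 \<omega> $ i\<bar>)) (d * (T * sqrt T))"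
    by (simp add: d_def)
  have l2\<kappa>: "l2_le M (\<lambda>_. \<kappa>) \<kappa>" by (simp add: l2_le_def prob_space)
  have l2E: "l2_le M E (exp ((L + 1) * T) * (T * (a + a + \<kappa>) + K * (d * (T * sqrt T))))"
    unfolding E_def using a \<kappa> T K d
    by (intro l2_le_cmult l2_le_add p0(1) q0(1) l2\<kappa> l2\<xi>) auto
  have pos: "0 < exp ((L + 1) * T) * (T * (a + a + \<kappa>) + K * (d * (T * sqrt T)))"
    using a \<kappa> T K d by (intro mult_pos_pos add_pos_pos) auto
  have "l2_le M (\<lambda>_. 3 * \<kappa>) (3 * \<kappa>)" using l2\<kappa> by (rule l2_le_cmult)
  then have l2\<Phi>: "l2_le M \<Phi> \<phi>"
    unfolding \<Phi>_def \<phi>_def using pos c L \<kappa>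
    by (intro l2_le_add[OF l2_le_cmult[OF l2E]] mult_pos_pos[OF _ pos]) auto
  have \<phi>: "0 < \<phi>"
    unfolding \<phi>_def using c L \<kappa> by (intro add_pos_pos[OF mult_pos_pos[OF _ pos]]) auto
  have "l2_le M G (2 * K * (d * (h * sqrt T)) + (L + 1) * h * \<phi>
      + (4 * c + 2 * L + 1) * exp (4 * c * (T + 1)) * (h * (2 * K * ((T + 1) * (d * sqrt T)) + (T + 1) * \<phi>)))"
    unfolding G_def
    by (intro l2_le_add l2_le_cmult l2\<rho> l2\<rho>sum l2\<Phi> n add_pos_pos mult_pos_pos add_nonneg_pos)
      (use K d h T L c \<phi> in auto)
  also have "2 * K * (d * (h * sqrt T)) + (L + 1) * h * \<phi>
      + (4 * c + 2 * L + 1) * exp (4 * c * (T + 1)) * (h * (2 * K * ((T + 1) * (d * sqrt T)) + (T + 1) * \<phi>))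
      = C * h"
    by (simp add: C_def algebra_simps)
  finally have l2G: "l2_le M G (C * h)" .
  have cW: "continuous_on {0..T} (\<lambda>t. W t \<omega>)" if "\<omega> \<in> space M" for \<omega>
    using bm that unfolding brownian_motion_def by blast
  have Wm: "W (real k * h) \<in> borel_measurable M" if "k \<le> N" for k
  proof (rule borel_measurable_filtration[OF filt tN[OF that]])
    show "W (real k * h) \<in> borel_measurable (F (real k * h))"
      using bm tN[OF that] unfolding brownian_motion_def by blast
  qed
  have "p (real n * h) \<in> borel_measurable (F (real n * h))" "q (real n * h) \<in> borel_measurable (F (real n * h))"
    using sde tN[OF n] unfolding sde_solution_def by blast+
  then have [measurable]: "p (real n * h) \<in> borel_measurable M" "q (real n * h) \<in> borel_measurable M"
    using borel_measurable_filtration[OF filt tN[OF n]] by blast+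
  have "L * h \<le> 1"
  proof -
    have "L * h * 1 \<le> L * h * (4 * (T + 1))" using L h T by (intro mult_left_mono) auto
    then show ?thesis using h(3) by (simp add: mult_ac)
  qed
  from drift_preserving_scheme_measurable[OF lip h(1,2) this Wm p0(2) q0(2) scheme n]
  have [measurable]: "P n \<in> borel_measurable M" "Q n \<in> borel_measurable M" by auto
  have "AE \<omega> in M. continuous_on {0..T} (\<lambda>t. p t \<omega>) \<and> continuous_on {0..T} (\<lambda>t. q t \<omega>)"
    and "AE \<omega> in M. \<forall>t\<in>{0..T}.
        q t \<omega> = q0 \<omega> + integral {0..t} (\<lambda>s. p s \<omega>) \<and>
        p t \<omega> = p0 \<omega> - integral {0..t} (\<lambda>s. f (q s \<omega>)) + S *v (W t \<omega> - W 0 \<omega>)"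
    using sde unfolding sde_solution_def by blast+
  \<comment> \<open>The integral equations hold almost surely, the scheme and the continuity of
    \<open>W\<close> at every point of \<open>space M\<close>; \<open>AE_space\<close> combines the
    two.\<close>
  then have "AE \<omega> in M. norm (q (real n * h) \<omega> - Q n \<omega>) \<le> G \<omega> \<and> norm (p (real n * h) \<omega> - P n \<omega>) \<le> G \<omega>"
    using AE_space
  proof eventually_elim
    case (elim \<omega>)
    note step = bspec[OF scheme[unfolded drift_preserving_scheme_def Let_def] elim(3)]
    note stepn = step[THEN conjunct2, THEN conjunct2, rule_format]
    note bound = pathwise_error_bound[where p = "\<lambda>t. p t \<omega>" and q = "\<lambda>t. q t \<omega>" and w = "\<lambda>t. W t \<omega>"
        and P = "\<lambda>n. P n \<omega>" and Q = "\<lambda>n. Q n \<omega>" and \<Psi> = "\<lambda>n. \<Psi> n \<omega>" and n = n,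
        OF lip h Nh _ _ cW[OF elim(3)] _ _ step[THEN conjunct1] step[THEN conjunct2, THEN conjunct1]
          refl stepn[THEN conjunct1] stepn[THEN conjunct2, THEN conjunct1]
          stepn[THEN conjunct2, THEN conjunct2] n \<kappa>(2) K(2),
        folded c_def, folded \<rho>_def, folded E_def, folded \<Phi>_def, folded G_def]
    show ?case
      using bound elim(1,2) by blast
  qed
  then have "AE \<omega> in M. \<bar>norm (q (real n * h) \<omega> - Q n \<omega>)\<bar> \<le> G \<omega>"
    and "AE \<omega> in M. \<bar>norm (p (real n * h) \<omega> - P n \<omega>)\<bar> \<le> G \<omega>"
    by auto
  then show "l2_le M (\<lambda>\<omega>. norm (q (real n * h) \<omega> - Q n \<omega>)) (C * h)"
    and "l2_le M (\<lambda>\<omega>. norm (p (real n * h) \<omega> - P n \<omega>)) (C * h)"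
    by (intro l2_le_dominated[OF l2G]; measurable)+
qed

theorem theorem4:
  fixes M :: "'a measure"
    and T :: real
    and V :: "real ^ 'm \<Rightarrow> real" and V' :: "real ^ 'm \<Rightarrow> real ^ 'm"
    and S :: "real ^ 'd ^ 'm"
    and p0 q0 :: "'a \<Rightarrow> real ^ 'm"
  assumes "prob_space M"
    and "T > 0"
    and "smooth V"
    and "\<And>x. GDERIV V x :> V' x"
    and "\<exists>L. L-lipschitz_on UNIV V'"
    and "integrable M (\<lambda>\<omega>. hamiltonian V (p0 \<omega>) (q0 \<omega>))"
    and "integrable M (\<lambda>\<omega>. (norm (p0 \<omega>))\<^sup>2 + (norm (q0 \<omega>))\<^sup>2)"
  shows "\<exists>hstar>0. \<exists>C>0.
    \<forall>(F :: real \<Rightarrow> 'a measure) (W :: real \<Rightarrow> 'a \<Rightarrow> real ^ 'd) p q.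
      normal_filtration M T F \<longrightarrow>
      brownian_motion M T F W \<longrightarrow>
      p0 \<in> borel_measurable (F 0) \<longrightarrow>
      q0 \<in> borel_measurable (F 0) \<longrightarrow>
      sde_solution M T F W V' S p0 q0 p q \<longrightarrow>
      (\<forall>h N \<Psi> P Q.
        0 < h \<longrightarrow> h \<le> hstar \<longrightarrow> real N * h = T \<longrightarrow>
        drift_preserving_scheme M W V' S p0 q0 h N \<Psi> P Q \<longrightarrow>
        (\<forall>n\<in>{1..N}.
          integrable M (\<lambda>\<omega>. (norm (q (real n * h) \<omega> - Q n \<omega>))\<^sup>2) \<and>
          integrable M (\<lambda>\<omega>. (norm (p (real n * h) \<omega> - P n \<omega>))\<^sup>2) \<and>
          sqrt (\<integral>\<omega>. (norm (q (real n * h) \<omega> - Q n \<omega>))\<^sup>2 \<partial>M) +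
          sqrt (\<integral>\<omega>. (norm (p (real n * h) \<omega> - P n \<omega>))\<^sup>2 \<partial>M) \<le> C * h))"
proof -
  obtain L where lip: "L-lipschitz_on UNIV V'" using assms(5) by blast
  have L: "L \<ge> 0" using lip by (rule lipschitz_on_nonneg)
  note T = \<open>T > 0\<close>
  define c where "c = L * (T + 1)"
  have c: "c \<ge> 0" using L T by (simp add: c_def)
  \<comment> \<open>Chosen so that \<open>h \<le> hstar\<close> yields both
    \<open>4 * c * h \<le> 1\<close> and \<open>h \<le> 1\<close>, also when
    \<open>c = 0\<close>.\<close>
  define hstar where "hstar = 1 / (4 * c + 1)"
  have hstar: "0 < hstar" "hstar \<le> 1" using c by (auto simp: hstar_def)
  \<comment> \<open>A common bound for both initial values; here and in \<open>\<kappa>\<close> and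
    \<open>K\<close> the added 1 provides the positivity that \<open>l2_le_add\<close>
    requires.\<close>
  define a where "a = sqrt ((\<integral>\<omega>. (norm (p0 \<omega>))\<^sup>2 + (norm (q0 \<omega>))\<^sup>2 \<partial>M) + 1)"
  have int0: "0 \<le> (\<integral>\<omega>. (norm (p0 \<omega>))\<^sup>2 + (norm (q0 \<omega>))\<^sup>2 \<partial>M)"
    by (intro Bochner_Integration.integral_nonneg) auto
  then have a: "0 < a" unfolding a_def by (intro real_sqrt_gt_zero add_nonneg_pos) auto
  \<comment> \<open>Integrability is assumed for the sum of the squares; it passes to each summand
    only with its measurability, which becomes available once a filtration is given.\<close>
  have initial: "l2_le M (\<lambda>\<omega>. norm (z \<omega>)) a"
    if [measurable]: "z \<in> borel_measurable M" and z: "z = p0 \<or> z = q0" for z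
  proof -
    have le: "(norm (z \<omega>))\<^sup>2 \<le> (norm (p0 \<omega>))\<^sup>2 + (norm (q0 \<omega>))\<^sup>2" for \<omega> using z by auto
    have i: "integrable M (\<lambda>\<omega>. (norm (z \<omega>))\<^sup>2)"
      by (rule Bochner_Integration.integrable_bound[OF assms(7)]) (use le in auto)
    have "(\<integral>\<omega>. (norm (z \<omega>))\<^sup>2 \<partial>M) \<le> (\<integral>\<omega>. (norm (p0 \<omega>))\<^sup>2 + (norm (q0 \<omega>))\<^sup>2 \<partial>M)"
      by (rule integral_mono[OF i assms(7) le])
    also have "\<dots> \<le> a\<^sup>2" using int0 by (simp add: a_def)
    finally show ?thesis using i by (simp add: l2_le_def)
  qed
  define \<kappa> where "\<kappa> = T * norm (V' 0) + 1"
  have \<kappa>: "0 < \<kappa>" "T * norm (V' 0) \<le> \<kappa>" using T by (auto simp: \<kappa>_def intro: add_nonneg_pos)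
  define K where "K = onorm ((*v) S) + 1"
  have K: "0 < K" "onorm ((*v) S) \<le> K"
    using onorm_pos_le[OF matrix_vector_mul_bounded_linear, of S] by (auto simp: K_def)
  define d where "d = real CARD('d)"
  define \<phi> where "\<phi> = (2 * c + 3 * L + 3) *
      (exp ((L + 1) * T) * (T * (a + a + \<kappa>) + K * (d * (T * sqrt T)))) + 3 * \<kappa>"
  \<comment> \<open>The constant of \<open>scheme_error_l2\<close>. It is built from
    \<open>T\<close>, \<open>L\<close>, \<open>V' 0\<close>, \<open>S\<close>, the noise dimension
    and the moments of the initial values, so it can be fixed before the filtration, the Brownian
    motion, the solution and the step size.\<close>
  define C where "C = 2 * K * (d * sqrt T) + (L + 1) * \<phi>
      + (4 * c + 2 * L + 1) * exp (4 * c * (T + 1)) * (2 * K * ((T + 1) * (d * sqrt T)) + (T + 1) * \<phi>)"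
  have d: "0 < d" by (simp add: d_def)
  have \<phi>: "0 < \<phi>" unfolding \<phi>_def
    using a \<kappa> T K d c L by (intro mult_pos_pos add_pos_pos add_nonneg_pos) auto
  have C: "0 < C" unfolding C_def
    using \<phi> T K d c L by (intro mult_pos_pos add_pos_pos add_nonneg_pos) auto
  \<comment> \<open>The factor 2 arises because each of the two root mean squares is at most
    \<open>C * h\<close>.\<close>
  have main: "integrable M (\<lambda>\<omega>. (norm (q (real n * h) \<omega> - Q n \<omega>))\<^sup>2) \<and>
      integrable M (\<lambda>\<omega>. (norm (p (real n * h) \<omega> - P n \<omega>))\<^sup>2) \<and>
      sqrt (\<integral>\<omega>. (norm (q (real n * h) \<omega> - Q n \<omega>))\<^sup>2 \<partial>M) +
      sqrt (\<integral>\<omega>. (norm (p (real n * h) \<omega> - P n \<omega>))\<^sup>2 \<partial>M) \<le> 2 * C * h"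
    if filt: "normal_filtration M T F" and bm: "brownian_motion M T F W"
      and p0: "p0 \<in> borel_measurable (F 0)" and q0: "q0 \<in> borel_measurable (F 0)"
      and sde: "sde_solution M T F W V' S p0 q0 p q"
      and h: "0 < h" "h \<le> hstar" and Nh: "real N * h = T"
      and scheme: "drift_preserving_scheme M W V' S p0 q0 h N \<Psi> P Q"
      and n: "n \<in> {1..N}"
    for F :: "real \<Rightarrow> 'a measure" and W :: "real \<Rightarrow> 'a \<Rightarrow> real ^ 'd" and p q h N \<Psi> P Q n
  proof -
    have m: "p0 \<in> borel_measurable M" "q0 \<in> borel_measurable M"
      using p0 q0 T borel_measurable_filtration[OF filt, of 0] by auto
    have "h * (4 * c + 1) \<le> 1" using h(2) c by (simp add: hstar_def pos_le_divide_eq)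
    then have h1: "4 * (L * (T + 1)) * h \<le> 1" using h by (simp add: c_def algebra_simps)
    have h2: "h \<le> 1" using h hstar by simp
    have "n \<le> N" using n by simp
    note err = scheme_error_l2[OF \<open>prob_space M\<close> T lip filt bm initial[OF m(1)] m(1) initial[OF m(2)] m(2)
        a sde h(1) h2 h1 Nh scheme \<open>n \<le> N\<close> \<kappa> K, folded c_def d_def, folded \<phi>_def, folded C_def]
    have "sqrt (\<integral>\<omega>. (z \<omega>)\<^sup>2 \<partial>M) \<le> C * h" if "l2_le M z (C * h)" for z
      using that C h by (intro real_le_lsqrt) (auto simp: l2_le_def)
    from this[OF err(1)] this[OF err(2)] err show ?thesis by (auto simp: l2_le_def)
  qed
  show ?thesis
    using hstar(1) C
    by (intro exI[of _ hstar] exI[of _ "2 * C"] conjI allI impI ballI main) (assumption | simp)+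
qed

end
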